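(* Let $n$ and $t$ be integers with $1 \leq t \leq n$, let $T = [t]$, and let $u$ be a non-negative real number such that $u > \frac{6-t}{3}$. Let $\mathcal{G}$ and $\mathcal{H}$ be non-empty compressed hereditary subfamilies of $2^{[n]}$. Let $g : \mathcal{G} \rightarrow \mathbb{R}^+$ and $h : \mathcal{H} \rightarrow \mathbb{R}^+$ be functions such that, for each $(\mathcal{F},w) \in \{(\mathcal{G},g),(\mathcal{H},h)\}$, (a) $w(A) \geq (t+u)\,w(B)$ for every $A, B \in \mathcal{F}$ with $A \subsetneq B$ and $|A| \geq t$, and (b) $w(\delta_{i,j}(C)) \geq w(C)$ for every $C \in \mathcal{F}$ and every $i,j \in [n]$ with $i < j$. If $\mathcal{A} \subseteq \mathcal{G}$ and $\mathcal{B} \subseteq \mathcal{H}$ are such that $\mathcal{A}$ and $\mathcal{B}$ are cross-$t$-intersecting, then \[g(\mathcal{A})\, h(\mathcal{B}) \leq g(\mathcal{G}(T))\, h(\mathcal{H}(T)).\] Moreover, if $u > 0$ and each of $\mathcal{G}$ and $\mathcal{H}$ has a member of size at least $t$, then the bound is attained if and only if $\mathcal{A} = \mathcal{G}(T')$ and $\mathcal{B} = \mathcal{H}(T')$ for some $T' \in \binom{[n]}{t}$ such that $g(\mathcal{G}(T')) = g(\mathcal{G}(T))$ and $h(\mathcal{H}(T')) = h(\mathcal{H}(T))$.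
   Context: $[n]=\{1,\dots,n\}$; $2^{[n]}$ is the family of all subsets of $[n]$; $\binom{[n]}{t}$ is the family of all $t$-element subsets of $[n]$; $\mathbb{R}^+$ is the set of positive real numbers. For a family $\mathcal{F}$ and a set $T$, $\mathcal{F}(T) = \{F \in \mathcal{F} : T \subseteq F\}$. For $i,j \in [n]$, $\delta_{i,j} : 2^{[n]} \to 2^{[n]}$ is defined by $\delta_{i,j}(A) = (A \setminus \{j\}) \cup \{i\}$ if $j \in A$ and $i \notin A$, and $\delta_{i,j}(A) = A$ otherwise. A family $\mathcal{F} \subseteq 2^{[n]}$ is compressed if $(F \setminus \{j\}) \cup \{i\} \in \mathcal{F}$ whenever $F \in \mathcal{F}$, $j \in F$, $i \in [n] \setminus F$ and $i < j$. A family is hereditary if it contains all subsets of each of its members. For a function $w : \mathcal{F} \to \mathbb{R}^+$ and $\mathcal{A} \subseteq \mathcal{F}$, $w(\mathcal{A}) = \sum_{A \in \mathcal{A}} w(A)$, with $w(\emptyset\text{ family}) = 0$. Families $\mathcal{A}$ and $\mathcal{B}$ (possibly empty) are cross-$t$-intersecting if $|A \cap B| \geq t$ for every $A \in \mathcal{A}$ and every $B \in \mathcal{B}$. *)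

theory Defs
  imports Complex_Main
begin

text \<open>The ground set \<open>[n]\<close> is \<open>{1..n} :: nat set\<close>. A weight function on a family \<open>\<F>\<close> is a
  total function \<open>nat set \<Rightarrow> real\<close> of which only the values on \<open>\<F>\<close> are ever used; the weight
  \<open>w(\<A>)\<close> of a subfamily is \<open>sum w \<A>\<close>.\<close>

definition members_containing :: "nat set set \<Rightarrow> nat set \<Rightarrow> nat set set" where
  "members_containing F T = {A \<in> F. T \<subseteq> A}"

definition shift :: "nat \<Rightarrow> nat \<Rightarrow> nat set \<Rightarrow> nat set" where
  "shift i j A = (if j \<in> A \<and> i \<notin> A then (A - {j}) \<union> {i} else A)"

definition compressed :: "nat \<Rightarrow> nat set set \<Rightarrow> bool" where
  "compressed n F \<longleftrightarrow>
     (\<forall>A\<in>F. \<forall>j\<in>A. \<forall>i\<in>{1..n} - A. i < j \<longrightarrow> (A - {j}) \<union> {i} \<in> F)"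

definition hereditary :: "nat set set \<Rightarrow> bool" where
  "hereditary F \<longleftrightarrow> (\<forall>A\<in>F. \<forall>B. B \<subseteq> A \<longrightarrow> B \<in> F)"

definition cross_intersecting :: "nat \<Rightarrow> nat set set \<Rightarrow> nat set set \<Rightarrow> bool" where
  "cross_intersecting t \<A> \<B> \<longleftrightarrow> (\<forall>A\<in>\<A>. \<forall>B\<in>\<B>. t \<le> card (A \<inter> B))"

end

theory Submission
  imports Defs
begin

text \<open>Put \<open>c = t + u\<close>, and call the star of a family its subfamily of members containing \<open>[t]\<close>.

  Shifting both families simultaneously keeps them cross-\<open>t\<close>-intersecting and, by (b), does not
  decrease weights; hence some pair \<open>\<A>, \<B>\<close> of largest product is compressed (\<open>compress_pair\<close>).
  Let \<open>p\<close> be least such that every \<open>X \<in> \<A>\<close> and \<open>Y \<in> \<B>\<close> share at least \<open>t\<close> elements of \<open>[p]\<close>.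
  If \<open>p = t\<close>, both families lie in their stars. Otherwise minimality of \<open>p\<close> yields tight pairs:
  \<open>X\<close> and \<open>Y\<close> that both contain \<open>p\<close> and share exactly \<open>t\<close> elements of \<open>[p]\<close>. Compressedness forces
  a tight pair to cover \<open>[p]\<close>, so its trace sizes \<open>i = |X \<inter> [p]|\<close> and \<open>j = |Y \<inter> [p]|\<close> satisfy
  \<open>i + j = p + t\<close>.

  The main tool is an exchange: discard the members of \<open>\<A>\<close> that have trace size \<open>i\<close> and belong to a
  tight pair, and add \<open>Y - {p}\<close> to \<open>\<B>\<close> for every such member \<open>Y\<close> of \<open>\<B>\<close> of trace size \<open>j\<close>.
  The result is again cross-\<open>t\<close>-intersecting, and for \<open>j > t\<close> hypothesis (a) says that the
  new sets weigh at least \<open>c\<close> times as much as the sets they come from. Let \<open>x\<close> and \<open>y\<close> be the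
  shares in the total weight of \<open>\<A>\<close> and \<open>\<B>\<close> taken by those members. Extremality gives
  \<open>c y (1 - x) \<le> x\<close>, and the symmetric exchange gives \<open>c x (1 - y) \<le> y\<close> when \<open>i > t\<close>. Moreover
  \<open>x \<le> i / p\<close>, by averaging over all replacements of \<open>p\<close> by a smaller missing element
  (\<open>critical_share\<close>). Since \<open>c > 2 (t + 3) / 3\<close>, these inequalities contradict each other
  whenever \<open>i, j > t\<close> and one of \<open>i, j\<close> exceeds \<open>t + 1\<close> (\<open>unbalanced_shares_impossible\<close>).

  Two cases remain. If \<open>i = t\<close>, all members of \<open>\<B>\<close> contain \<open>[p]\<close>, so \<open>y = 1\<close> and the exchange leaves
  only \<open>u = 0\<close> and \<open>p = t + 1\<close>, where the exchanged pair lies in the stars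
  (\<open>bound_if_critical_t\<close>). If \<open>i = j = t + 1\<close>, then \<open>p = t + 2\<close>, and the families are compared
  with their stars directly: a member of trace size \<open>t + 1\<close> outside the star misses exactly one
  \<open>q \<in> [t]\<close>, and replacing \<open>t + 1\<close> by \<open>q\<close> and deleting \<open>t + 2\<close> turns it into a set of trace
  \<open>[t]\<close> which is at least \<open>c\<close> times heavier (\<open>star_defect\<close>). Sets of trace \<open>[t]\<close> cannot occur in
  both families, and the resulting loss outweighs the gain (\<open>bound_if_balanced\<close>).

  All these estimates are strict for \<open>u > 0\<close>, so then the compressed extremal pairs are the
  stars. Extremality passes back through the shifts by means of the common member \<open>[t]\<close>: a common
  \<open>t\<close>-element member of the shifted families comes from a common \<open>t\<close>-element member \<open>S\<close>
  of the original ones (\<open>common_member_compress\<close>), and such an \<open>S\<close> is contained in every member of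
  both families.\<close>

section \<open>Compressions\<close>

lemma cross_intersecting_sym: "cross_intersecting t \<A> \<B> \<Longrightarrow> cross_intersecting t \<B> \<A>"
  unfolding cross_intersecting_def by (subst Int_commute) blast

lemma compressedD:
  "\<lbrakk>compressed n F; X \<in> F; j \<in> X; i \<in> {1..n}; i \<notin> X; i < j\<rbrakk> \<Longrightarrow> insert i (X - {j}) \<in> F"
  by (simp add: compressed_def)

lemma shift_eq: "\<lbrakk>j \<in> X; i \<notin> X\<rbrakk> \<Longrightarrow> shift i j X = insert i (X - {j})"
  by (auto simp: shift_def)

lemma shift_neqD: "shift i j X \<noteq> X \<Longrightarrow> j \<in> X \<and> i \<notin> X"
  unfolding shift_def by (cases "j \<in> X \<and> i \<notin> X") (simp_all only: if_False if_True simp_thms)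

text \<open>The image \<open>compress_member i j \<A> ` \<A>\<close> is the usual \<open>(i, j)\<close>-compression of \<open>\<A>\<close>. Keeping the map on
  individual members makes its injectivity available for comparing weights.\<close>
definition compress_member :: "nat \<Rightarrow> nat \<Rightarrow> nat set set \<Rightarrow> nat set \<Rightarrow> nat set" where
  "compress_member i j \<A> X = (if shift i j X \<in> \<A> then X else shift i j X)"

lemma inj_on_compress_member: "inj_on (compress_member i j \<A>) \<A>"
proof (rule inj_onI)
  fix X Y
  assume X: "X \<in> \<A>" and Y: "Y \<in> \<A>"
    and eq: "compress_member i j \<A> X = compress_member i j \<A> Y"
  have moved: "j \<in> Z" "i \<notin> Z" "insert j (shift i j Z - {i}) = Z"
    if "Z \<in> \<A>" "shift i j Z \<notin> \<A>" for Z
    using that by (auto simp: shift_def split: if_splits)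
  show "X = Y"
  proof (cases "shift i j X \<in> \<A>")
    case True
    then have "shift i j Y \<in> \<A>" using eq X by (auto simp: compress_member_def split: if_splits)
    then show ?thesis using True eq by (simp add: compress_member_def)
  next
    case False
    then have "shift i j Y \<notin> \<A>" using eq Y by (auto simp: compress_member_def split: if_splits)
    then have same: "shift i j X = shift i j Y" using False eq by (simp add: compress_member_def)
    have "X = insert j (shift i j X - {i})" using moved(3)[OF X False] by (rule sym)
    also have "\<dots> = insert j (shift i j Y - {i})" by (simp only: same)
    also have "\<dots> = Y" using moved(3)[OF Y \<open>shift i j Y \<notin> \<A>\<close>] .
    finally show ?thesis .
  qed
qed

lemma card_insert_Diff_same: "\<lbrakk>finite S; j \<in> S; i \<notin> S\<rbrakk> \<Longrightarrow> card (insert i (S - {j})) = card S"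
  by (simp add: card_Suc_Diff1 del: card_Diff_insert)

text \<open>Moving both members, or neither, keeps the size of their intersection. If only \<open>X\<close> moves, the
  intersection can shrink only when \<open>Y\<close> contains \<open>j\<close> but not \<open>i\<close>; then \<open>Y\<close> stayed because its shift
  is in \<open>\<B>\<close>, and \<open>shift i j X \<inter> Y = X \<inter> shift i j Y\<close>.\<close>
lemma card_Int_compress_member:
  assumes ij: "i \<noteq> j" and fin: "finite X" "finite Y"
    and X: "X \<in> \<A>" and Y: "Y \<in> \<B>" and cross: "cross_intersecting t \<A> \<B>"
  shows "t \<le> card (compress_member i j \<A> X \<inter> compress_member i j \<B> Y)"
proof -
  have both: "t \<le> card (P \<inter> Q)" if "P \<in> \<A>" "Q \<in> \<B>" for P Q
    using cross that by (auto simp: cross_intersecting_def)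
  have XY: "t \<le> card (X \<inter> Y)" using both X Y by blast
  \<comment> \<open>The mixed case, for either family: only the first of the two members is moved.\<close>
  have mixed: "t \<le> card (shift i j P \<inter> Q)"
    if PQ: "finite P" "finite Q" "t \<le> card (P \<inter> Q)" "j \<in> P" "i \<notin> P"
      and alt: "j \<notin> Q \<or> i \<in> Q \<or> t \<le> card (P \<inter> shift i j Q)" for P Q
  proof -
    have sh: "shift i j P = insert i (P - {j})" using PQ by (auto simp: shift_def)
    consider "j \<notin> Q" | "j \<in> Q" "i \<in> Q" | "j \<in> Q" "i \<notin> Q" "t \<le> card (P \<inter> shift i j Q)"
      using alt by blast
    then show ?thesis
    proof cases
      case 1
      then have "P \<inter> Q \<subseteq> shift i j P \<inter> Q" using sh by auto
      then have "card (P \<inter> Q) \<le> card (shift i j P \<inter> Q)"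
        using PQ by (intro card_mono) auto
      then show ?thesis using PQ by linarith
    next
      case 2
      then have "shift i j P \<inter> Q = insert i ((P \<inter> Q) - {j})" using sh ij by auto
      moreover have "card (insert i ((P \<inter> Q) - {j})) = card (P \<inter> Q)"
        using PQ 2 by (intro card_insert_Diff_same) auto
      ultimately show ?thesis using PQ by simp
    next
      case 3
      have "shift i j Q = insert i (Q - {j})" using 3 by (auto simp: shift_def)
      then have "shift i j P \<inter> Q = P \<inter> shift i j Q" using sh PQ 3 by auto
      then show ?thesis using 3 by simp
    qed
  qed
  show ?thesis
  proof (cases "shift i j X \<in> \<A>"; cases "shift i j Y \<in> \<B>")
    assume "shift i j X \<in> \<A>" "shift i j Y \<in> \<B>"
    then show ?thesis using XY by (simp add: compress_member_def)
  next
    assume a: "shift i j X \<in> \<A>" "shift i j Y \<notin> \<B>"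
    then have "j \<in> Y" "i \<notin> Y" using Y by (auto simp: shift_def split: if_splits)
    then have "t \<le> card (shift i j Y \<inter> X)"
      using mixed[of Y X] fin XY both[OF a(1) Y] by (simp add: Int_commute)
    then show ?thesis using a by (simp add: compress_member_def Int_commute)
  next
    assume a: "shift i j X \<notin> \<A>" "shift i j Y \<in> \<B>"
    then have "j \<in> X" "i \<notin> X" using X by (auto simp: shift_def split: if_splits)
    then have "t \<le> card (shift i j X \<inter> Y)"
      using mixed[of X Y] fin XY both[OF X a(2)] by simp
    then show ?thesis using a by (simp add: compress_member_def)
  next
    assume a: "shift i j X \<notin> \<A>" "shift i j Y \<notin> \<B>"
    then have m: "j \<in> X" "i \<notin> X" "j \<in> Y" "i \<notin> Y"
      using X Y by (auto simp: shift_def split: if_splits)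
    then have "shift i j X \<inter> shift i j Y = insert i ((X \<inter> Y) - {j})"
      by (auto simp: shift_def)
    moreover have "card (insert i ((X \<inter> Y) - {j})) = card (X \<inter> Y)"
      using m fin by (intro card_insert_Diff_same) auto
    ultimately show ?thesis using a XY by (simp add: compress_member_def)
  qed
qed

lemma sum_shift_le:
  assumes "i < j" "finite X"
  shows "\<Sum>(shift i j X) \<le> \<Sum>X"
    and "shift i j X \<noteq> X \<Longrightarrow> \<Sum>(shift i j X) < \<Sum>X"
proof -
  have less: "\<Sum>(shift i j X) < \<Sum>X" if "shift i j X \<noteq> X"
  proof -
    have m: "j \<in> X" "i \<notin> X" using shift_neqD[OF that] by blast+
    then have "shift i j X = insert i (X - {j})" by (simp add: shift_def)
    then have "\<Sum>(shift i j X) = i + \<Sum>(X - {j})" using m assms by simp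
    moreover have "\<Sum>X = j + \<Sum>(X - {j})" by (rule sum.remove) (use m assms in auto)
    ultimately show ?thesis using assms by linarith
  qed
  show "\<Sum>(shift i j X) < \<Sum>X" if "shift i j X \<noteq> X" using less that .
  show "\<Sum>(shift i j X) \<le> \<Sum>X"
  proof (cases "shift i j X = X")
    case True then show ?thesis by simp
  next
    case False then show ?thesis using less by (blast intro: less_imp_le)
  qed
qed

section \<open>Weighted families\<close>

text \<open>One family with its weight function; the constant \<open>c\<close> stands for \<open>t + u\<close>, and \<open>c_gt\<close> is the
  hypothesis \<open>u > (6 - t) / 3\<close> in terms of \<open>c\<close>.\<close>
locale weighted_family =
  fixes n t :: nat and c :: real and F :: "nat set set" and w :: "nat set \<Rightarrow> real"
  assumes t_pos: "1 \<le> t"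
    and c_ge: "real t \<le> c" and c_gt: "2 * real t + 6 < 3 * c"
    and F_sub: "F \<subseteq> Pow {1..n}" and F_comp: "compressed n F" and F_her: "hereditary F"
    and w_pos: "X \<in> F \<Longrightarrow> 0 < w X"
    and w_drop: "\<lbrakk>X \<in> F; Y \<in> F; X \<subset> Y; t \<le> card X\<rbrakk> \<Longrightarrow> c * w Y \<le> w X"
    and w_shift: "\<lbrakk>X \<in> F; i \<in> {1..n}; j \<in> {1..n}; i < j\<rbrakk> \<Longrightarrow> w X \<le> w (shift i j X)"
begin

lemma c_pos: "2 < c" using c_gt by simp

lemma finite_F: "finite F" using F_sub finite_subset by blast

lemma finite_member: "X \<in> F \<Longrightarrow> finite X"
  using F_sub finite_subset by blast

lemma subset_mem: "\<lbrakk>X \<in> F; Y \<subseteq> X\<rbrakk> \<Longrightarrow> Y \<in> F"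
  using F_her by (auto simp: hereditary_def)

lemma shift_mem:
  assumes "X \<in> F" "i \<in> {1..n}" "i < j" shows "shift i j X \<in> F"
  using compressedD[OF F_comp assms(1), of j i] assms by (auto simp: shift_def)

lemma w_insert_Diff:
  assumes "X \<in> F" "j \<in> X" "i \<notin> X" "1 \<le> i" "i < j"
  shows "insert i (X - {j}) \<in> F" "w X \<le> w (insert i (X - {j}))"
proof -
  have "j \<in> {1..n}" using assms F_sub by blast
  moreover from this have "i \<in> {1..n}" using assms by auto
  ultimately show "insert i (X - {j}) \<in> F" "w X \<le> w (insert i (X - {j}))"
    using w_shift[of X i j] shift_mem[of X i j] shift_eq[of j X i] assms by auto
qed

lemma sum_mono_subset: "\<lbrakk>\<A> \<subseteq> \<B>; \<B> \<subseteq> F\<rbrakk> \<Longrightarrow> sum w \<A> \<le> sum w \<B>"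
  by (rule sum_mono2) (use finite_F finite_subset less_imp_le[OF w_pos] in auto)

lemma sum_w_nonneg: "\<A> \<subseteq> F \<Longrightarrow> 0 \<le> sum w \<A>"
  by (rule sum_nonneg) (use less_imp_le[OF w_pos] in auto)

lemma sum_w_pos: "\<lbrakk>\<A> \<subseteq> F; X \<in> \<A>\<rbrakk> \<Longrightarrow> 0 < sum w \<A>"
  by (rule sum_pos) (use w_pos finite_F finite_subset in auto)

lemma sum_Un_disjoint:
  "\<lbrakk>\<A> \<subseteq> F; \<B> \<subseteq> F; \<A> \<inter> \<B> = {}\<rbrakk> \<Longrightarrow> sum w (\<A> \<union> \<B>) = sum w \<A> + sum w \<B>"
  by (rule sum.union_disjoint) (use finite_F finite_subset in auto)

lemma eq_of_sum_ge:
  assumes "\<A> \<subseteq> \<B>" "\<B> \<subseteq> F" "sum w \<B> \<le> sum w \<A>" shows "\<A> = \<B>"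
proof (rule ccontr)
  assume "\<A> \<noteq> \<B>"
  then obtain X where X: "X \<in> \<B> - \<A>" using assms by auto
  have "sum w \<B> = sum w \<A> + sum w (\<B> - \<A>)"
    using sum_Un_disjoint[of \<A> "\<B> - \<A>"] assms by (auto simp: Un_absorb1)
  moreover have "0 < sum w (\<B> - \<A>)" using sum_w_pos[of "\<B> - \<A>" X] X assms by auto
  ultimately show False using assms by linarith
qed

text \<open>A \<open>t\<close>-element member with the least element sum is \<open>[t]\<close>, since otherwise a shift lowers the sum.\<close>
lemma initial_mem:
  assumes "X \<in> F" "t \<le> card X" shows "{1..t} \<in> F"
proof -
  obtain S0 where S0: "S0 \<subseteq> X" "card S0 = t" using assms by (meson obtain_subset_with_card_n)
  have "\<exists>S. S \<in> F \<and> card S = t" using S0 assms subset_mem by blast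
  then obtain S where S: "S \<in> F" "card S = t"
    and least: "\<And>S'. S' \<in> F \<and> card S' = t \<Longrightarrow> \<Sum>S \<le> \<Sum>S'"
    using ex_has_least_nat[of "\<lambda>S. S \<in> F \<and> card S = t" _ "\<lambda>S. \<Sum>S"] by metis
  have fS: "finite S" using S finite_member by blast
  have "{1..t} \<subseteq> S"
  proof
    fix i assume i: "i \<in> {1..t}"
    show "i \<in> S"
    proof (rule ccontr)
      assume iS: "i \<notin> S"
      have "\<not> S \<subseteq> {1..t}"
      proof
        assume "S \<subseteq> {1..t}"
        then have "S = {1..t}" using S by (intro card_subset_eq) auto
        then show False using i iS by auto
      qed
      then obtain j where j: "j \<in> S" "j \<notin> {1..t}" by blast
      have "j \<in> {1..n}" using j S F_sub by blast
      then have ij: "i < j" using j i by auto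
      have "insert i (S - {j}) \<in> F" using w_insert_Diff[of S j i] S j i iS ij by auto
      moreover have "card (insert i (S - {j})) = t"
        using card_insert_Diff_same[of S j i] S j iS fS by simp
      moreover have "\<Sum>(shift i j S) < \<Sum>S"
        using sum_shift_le(2)[of i j S] ij fS shift_eq[of j S i] j iS by blast
      ultimately show False using least shift_eq[of j S i] j iS by (metis not_less)
    qed
  qed
  then have "{1..t} = S" using S fS by (intro card_subset_eq) auto
  then show ?thesis using S by simp
qed

lemma compress_member_mem:
  assumes "\<A> \<subseteq> F" "X \<in> \<A>" "i \<in> {1..n}" "i < j"
  shows "compress_member i j \<A> X \<in> F"
  using assms shift_mem[of X i j] by (auto simp: compress_member_def)

lemma w_compress_member:
  assumes "\<A> \<subseteq> F" "X \<in> \<A>" "i \<in> {1..n}" "j \<in> {1..n}" "i < j"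
  shows "w X \<le> w (compress_member i j \<A> X)"
  using assms w_shift[of X i j] by (auto simp: compress_member_def)

lemma sum_compress:
  assumes "\<A> \<subseteq> F" "i \<in> {1..n}" "j \<in> {1..n}" "i < j"
  shows "sum w \<A> \<le> sum w (compress_member i j \<A> ` \<A>)"
  by (simp add: sum.reindex[OF inj_on_compress_member])
    (rule sum_mono, rule w_compress_member, use assms in auto)

text \<open>The sum of all elements of all members is the termination measure for repeated compression.\<close>
lemma total_compress:
  fixes i j :: nat
  assumes "\<A> \<subseteq> F" "i < j"
  shows "(\<Sum>X\<in>compress_member i j \<A> ` \<A>. \<Sum>X) \<le> (\<Sum>X\<in>\<A>. \<Sum>X)"
    and "X \<in> \<A> \<Longrightarrow> shift i j X \<notin> \<A> \<Longrightarrow>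
      (\<Sum>X\<in>compress_member i j \<A> ` \<A>. \<Sum>X) < (\<Sum>X\<in>\<A>. \<Sum>X)"
proof -
  have le: "\<Sum>(compress_member i j \<A> Y) \<le> \<Sum>Y" if "Y \<in> \<A>" for Y
    using that assms sum_shift_le(1)[of i j Y] finite_member by (auto simp: compress_member_def)
  show "(\<Sum>X\<in>compress_member i j \<A> ` \<A>. \<Sum>X) \<le> (\<Sum>X\<in>\<A>. \<Sum>X)"
    by (simp add: sum.reindex[OF inj_on_compress_member]) (rule sum_mono, rule le)
  assume X: "X \<in> \<A>" "shift i j X \<notin> \<A>"
  then have "shift i j X \<noteq> X" by auto
  then have "\<Sum>(compress_member i j \<A> X) < \<Sum>X"
    using X assms sum_shift_le(2)[of i j X] finite_member by (auto simp: compress_member_def)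
  moreover have "finite \<A>" using assms finite_F finite_subset by blast
  ultimately show "(\<Sum>X\<in>compress_member i j \<A> ` \<A>. \<Sum>X) < (\<Sum>X\<in>\<A>. \<Sum>X)"
    by (simp add: sum.reindex[OF inj_on_compress_member])
      (rule sum_strict_mono_ex1, use le X in auto)
qed

definition star :: "nat set set" where
  "star = members_containing F {1..t}"

text \<open>The core collects the heavy part of the star in the case \<open>p = t + 2\<close>: its members have the
  smallest possible trace on \<open>[t + 2]\<close>.\<close>
definition core :: "nat set set" where
  "core = {X \<in> F. X \<inter> {1..t + 2} = {1..t}}"

lemma star_sub: "star \<subseteq> F" and core_sub: "core \<subseteq> star"
  by (auto simp: star_def core_def members_containing_def)

lemma core_pos:
  assumes "X \<in> F" "t \<le> card X" shows "0 < sum w core"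
  using sum_w_pos[of core "{1..t}"] initial_mem[OF assms] star_sub core_sub
  by (auto simp: core_def)

text \<open>The counting step behind the two comparisons with the core: each member of \<open>D\<close> is sent to a set
  of \<open>E\<close> at least \<open>c\<close> times as heavy, and a label from \<open>R\<close> makes the assignment injective.\<close>
lemma sum_le_times_card:
  assumes D: "D \<subseteq> F" and E: "E \<subseteq> F" and R: "finite R"
    and img: "\<And>X. X \<in> D \<Longrightarrow> \<phi> X \<in> E" "\<And>X. X \<in> D \<Longrightarrow> \<rho> X \<in> R"
    and inj: "inj_on (\<lambda>X. (\<phi> X, \<rho> X)) D"
    and le: "\<And>X. X \<in> D \<Longrightarrow> c * w X \<le> w (\<phi> X)"
  shows "c * sum w D \<le> real (card R) * sum w E"
proof -
  have finE: "finite E" using E finite_F finite_subset by blast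
  have "c * sum w D \<le> (\<Sum>X\<in>D. w (\<phi> X))"
    unfolding sum_distrib_left by (rule sum_mono) (rule le)
  also have "\<dots> = (\<Sum>Z\<in>(\<lambda>X. (\<phi> X, \<rho> X)) ` D. w (fst Z))"
    by (simp add: sum.reindex[OF inj])
  also have "\<dots> \<le> (\<Sum>Z\<in>E \<times> R. w (fst Z))"
    using img E finE R less_imp_le[OF w_pos] by (intro sum_mono2) auto
  also have "\<dots> = (\<Sum>Z\<in>E. \<Sum>r\<in>R. w Z)"
    unfolding sum.cartesian_product by (simp only: split_def)
  also have "\<dots> = real (card R) * sum w E"
    by (simp add: sum_distrib_left)
  finally show ?thesis .
qed

text \<open>A set of trace size \<open>t + 1\<close> that misses some \<open>q \<in> [t]\<close> has trace \<open>[t + 2] - {q}\<close>. Deleting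
  \<open>t + 2\<close> gains the factor \<open>c\<close>, shifting \<open>t + 1\<close> to \<open>q\<close> loses nothing, and the set can be
  recovered from the result and \<open>q\<close>, for which there are \<open>t\<close> choices.\<close>
lemma star_defect:
  "c * sum w {X \<in> F. card (X \<inter> {1..t + 2}) = t + 1 \<and> \<not> {1..t} \<subseteq> X} \<le> real t * sum w core"
proof -
  let ?D = "{X \<in> F. card (X \<inter> {1..t + 2}) = t + 1 \<and> \<not> {1..t} \<subseteq> X}"
  define \<rho> where "\<rho> X = (SOME q. q \<in> {1..t} - X)" for X :: "nat set"
  define \<phi> where "\<phi> X = insert (\<rho> X) (X - {t + 2} - {t + 1})" for X
  have \<rho>: "\<rho> X \<in> {1..t}" "\<rho> X \<notin> X" "X \<inter> {1..t + 2} = {1..t + 2} - {\<rho> X}" if "X \<in> ?D" for X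
  proof -
    have "\<exists>q. q \<in> {1..t} - X" using that by blast
    then have q: "\<rho> X \<in> {1..t} - X" unfolding \<rho>_def by (rule someI_ex)
    then show "\<rho> X \<in> {1..t}" "\<rho> X \<notin> X" by auto
    have "card ({1..t + 2} - {\<rho> X}) = t + 1" using q by (subst card_Diff_singleton) auto
    then show "X \<inter> {1..t + 2} = {1..t + 2} - {\<rho> X}"
      using that q by (intro card_subset_eq) auto
  qed
  have top: "t + 1 \<in> X" "t + 2 \<in> X" if "X \<in> ?D" for X
  proof -
    have "t + 1 \<in> {1..t + 2} - {\<rho> X}" "t + 2 \<in> {1..t + 2} - {\<rho> X}" using \<rho>(1)[OF that] by auto
    then show "t + 1 \<in> X" "t + 2 \<in> X" using \<rho>(3)[OF that] by blast+
  qed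
  have \<phi>: "\<phi> X \<in> core" "c * w X \<le> w (\<phi> X)" if X: "X \<in> ?D" for X
  proof -
    have mem: "X \<in> F" "X - {t + 2} \<in> F" using X subset_mem[of X "X - {t + 2}"] by auto
    have "{1..t + 2} - {\<rho> X} - {t + 2} \<subseteq> X - {t + 2}" using \<rho>[OF X] by blast
    moreover have "card ({1..t + 2} - {\<rho> X} - {t + 2}) = t"
      using \<rho>(1)[OF X] by (subst card_Diff_singleton, simp, subst card_Diff_singleton) auto
    ultimately have "t \<le> card (X - {t + 2})"
      using mem finite_member by (metis card_mono)
    moreover have "X - {t + 2} \<subset> X" using top[OF X] by blast
    ultimately have "c * w X \<le> w (X - {t + 2})" using mem w_drop by blast
    moreover have "\<phi> X \<in> F" "w (X - {t + 2}) \<le> w (\<phi> X)"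
      using w_insert_Diff[of "X - {t + 2}" "t + 1" "\<rho> X"] mem top[OF X] \<rho>[OF X]
      unfolding \<phi>_def by auto
    moreover have "\<phi> X \<inter> {1..t + 2} = insert (\<rho> X) (X \<inter> {1..t + 2} - {t + 2} - {t + 1})"
      using \<rho>(1)[OF X] unfolding \<phi>_def by auto
    moreover have "\<dots> = {1..t}"
      unfolding \<rho>(3)[OF X] using \<rho>(1)[OF X] by auto
    ultimately show "\<phi> X \<in> core" "c * w X \<le> w (\<phi> X)" by (auto simp: core_def)
  qed
  have inv: "X = insert (t + 2) (insert (t + 1) (\<phi> X - {\<rho> X}))" if "X \<in> ?D" for X
    using \<rho>(2)[OF that] top[OF that] unfolding \<phi>_def by auto
  have "inj_on (\<lambda>X. (\<phi> X, \<rho> X)) ?D"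
    by (rule inj_onI) (metis (no_types, lifting) inv Pair_inject)
  then have "c * sum w ?D \<le> real (card {1..t}) * sum w core"
    using \<phi> \<rho>(1) star_sub core_sub by (intro sum_le_times_card) auto
  then show ?thesis by simp
qed

text \<open>Here a member is recovered from its core set and its nonempty intersection with
  \<open>{t + 1, t + 2}\<close>, for which there are three choices.\<close>
lemma star_upper_part:
  assumes "\<A> \<subseteq> star" and large: "\<And>X. X \<in> \<A> \<Longrightarrow> t + 1 \<le> card (X \<inter> {1..t + 2})"
  shows "c * sum w \<A> \<le> 3 * sum w core"
proof -
  let ?R = "{{t + 1}, {t + 2}, {t + 1, t + 2}}"
  let ?\<phi> = "\<lambda>X. X - {t + 1, t + 2}" and ?\<rho> = "\<lambda>X. X \<inter> {t + 1, t + 2}"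
  have X: "X \<in> F" "{1..t} \<subseteq> X" if "X \<in> \<A>" for X
    using that assms by (auto simp: star_def members_containing_def)
  have meets: "?\<rho> X \<noteq> {}" if "X \<in> \<A>" for X
  proof
    assume "?\<rho> X = {}"
    then have "X \<inter> {1..t + 2} \<subseteq> {1..t}" by (auto simp: le_Suc_eq)
    then have "card (X \<inter> {1..t + 2}) \<le> t" using card_mono[of "{1..t}"] by fastforce
    then show False using large[OF that] by simp
  qed
  have core_mem: "?\<phi> X \<in> core" if "X \<in> \<A>" for X
    using X[OF that] subset_mem[of X "?\<phi> X"] unfolding core_def by (auto simp: le_Suc_eq)
  have "c * w X \<le> w (?\<phi> X)" if "X \<in> \<A>" for X
  proof (rule w_drop)
    show "?\<phi> X \<in> F" "X \<in> F" using core_mem[OF that] X[OF that] by (auto simp: core_def)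
    show "?\<phi> X \<subset> X" using meets[OF that] by blast
    have "{1..t} \<subseteq> ?\<phi> X" using X[OF that] by auto
    then have "card {1..t} \<le> card (?\<phi> X)"
      by (rule card_mono[rotated]) (use finite_member X[OF that] in blast)
    then show "t \<le> card (?\<phi> X)" by simp
  qed
  moreover have "inj_on (\<lambda>X. (?\<phi> X, ?\<rho> X)) \<A>"
    by (rule inj_onI) blast
  moreover have "?\<rho> X \<in> ?R" if "X \<in> \<A>" for X using meets[OF that] by auto
  ultimately have "c * sum w \<A> \<le> real (card ?R) * sum w core"
    using core_mem X star_sub core_sub by (intro sum_le_times_card) auto
  also have "card ?R = 3" by (simp add: doubleton_eq_iff)
  finally show ?thesis by simp
qed

end

section \<open>Compressing two families simultaneously\<close>
locale weighted_pair =
  G: weighted_family n t c G g + H: weighted_family n t c H h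
  for n t :: nat and c :: real and G :: "nat set set" and g :: "nat set \<Rightarrow> real"
    and H :: "nat set set" and h :: "nat set \<Rightarrow> real"
begin

lemma swap: "weighted_pair n t c H h G g"
  by (rule weighted_pair.intro) (rule H.weighted_family_axioms G.weighted_family_axioms)+

text \<open>A \<open>t\<close>-element set \<open>S\<close> in the compression comes from \<open>S\<close> itself or from \<open>S' = S - {i} \<union> {j}\<close>. Both
  families must offer the same one of the two, because \<open>S\<close> and \<open>S'\<close> share only \<open>t - 1\<close> elements.\<close>
lemma common_member_compress:
  assumes cross: "cross_intersecting t \<A> \<B>" and ij: "i \<noteq> j" and S: "card S = t"
    and SA: "S \<in> compress_member i j \<A> ` \<A>" and SB: "S \<in> compress_member i j \<B> ` \<B>"
  shows "\<exists>S'. card S' = t \<and> S' \<in> \<A> \<and> S' \<in> \<B>"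
proof -
  have fin: "finite S" using S G.t_pos by (metis card.infinite not_one_le_zero)
  have unmoved: "S \<in> \<F> \<or> (i \<in> S \<and> j \<notin> S \<and> insert j (S - {i}) \<in> \<F>)"
    if mem: "S \<in> compress_member i j \<F> ` \<F>" for \<F>
  proof -
    obtain X where X: "X \<in> \<F>" "S = compress_member i j \<F> X" using mem by blast
    show ?thesis
    proof (cases "shift i j X \<in> \<F>")
      case True then show ?thesis using X by (simp add: compress_member_def)
    next
      case False
      then have "j \<in> X" "i \<notin> X" using X by (auto simp: shift_def split: if_splits)
      moreover from this have "S = insert i (X - {j})"
        using False X by (auto simp: compress_member_def shift_def)
      ultimately have "i \<in> S" "j \<notin> S" "insert j (S - {i}) = X" using ij by auto
      then show ?thesis using X by simp
    qed
  qed
  have meet: "t \<le> card (P \<inter> Q)" if "P \<in> \<A>" "Q \<in> \<B>" for P Q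
    using cross that by (auto simp: cross_intersecting_def)
  let ?S' = "insert j (S - {i})"
  have small: "card (S \<inter> ?S') < t" "card (?S' \<inter> S) < t" if "i \<in> S" "j \<notin> S"
  proof -
    have "S \<inter> ?S' \<subset> S" using that by auto
    then show "card (S \<inter> ?S') < t" using psubset_card_mono[OF fin] S by blast
    then show "card (?S' \<inter> S) < t" by (simp add: Int_commute)
  qed
  have cardS': "card ?S' = t" if "i \<in> S" "j \<notin> S"
    using that S fin card_insert_Diff_same[of S i j] by simp
  show ?thesis
    using unmoved[OF SA] unmoved[OF SB]
  proof (elim disjE conjE)
    assume "S \<in> \<A>" "S \<in> \<B>" then show ?thesis using S by blast
  next
    assume "i \<in> S" "j \<notin> S" "S \<in> \<A>" "?S' \<in> \<B>"
    then show ?thesis using meet[of S ?S'] small by linarith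
  next
    assume "i \<in> S" "j \<notin> S" "?S' \<in> \<A>" "S \<in> \<B>"
    then show ?thesis using meet[of ?S' S] small by linarith
  next
    assume "i \<in> S" "j \<notin> S" "?S' \<in> \<A>" "?S' \<in> \<B>"
    then show ?thesis using cardS' by blast
  qed
qed

lemma compress_pair:
  assumes "\<A> \<subseteq> G" "\<B> \<subseteq> H" "cross_intersecting t \<A> \<B>"
  shows "\<exists>\<A>' \<B>'. \<A>' \<subseteq> G \<and> \<B>' \<subseteq> H \<and> cross_intersecting t \<A>' \<B>'
    \<and> compressed n \<A>' \<and> compressed n \<B>' \<and> sum g \<A> \<le> sum g \<A>' \<and> sum h \<B> \<le> sum h \<B>'
    \<and> (\<forall>S. card S = t \<longrightarrow> S \<in> \<A>' \<longrightarrow> S \<in> \<B>' \<longrightarrow> (\<exists>S'. card S' = t \<and> S' \<in> \<A> \<and> S' \<in> \<B>))"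
  using assms
proof (induction "(\<Sum>X\<in>\<A>. \<Sum>X) + (\<Sum>X\<in>\<B>. \<Sum>X)" arbitrary: \<A> \<B> rule: less_induct)
  case less
  show ?case
  proof (cases "compressed n \<A> \<and> compressed n \<B>")
    case True
    then show ?thesis using less.prems by blast
  next
    case False
    have witness: "\<exists>i j X. i \<in> {1..n} \<and> i < j \<and> j \<in> X \<and> X \<in> \<F> \<and> shift i j X \<notin> \<F>"
      if "\<not> compressed n \<F>" for \<F>
    proof -
      obtain X i j where "X \<in> \<F>" "j \<in> X" "i \<in> {1..n} - X" "i < j" "X - {j} \<union> {i} \<notin> \<F>"
        using \<open>\<not> compressed n \<F>\<close> unfolding compressed_def by blast
      moreover from this have "shift i j X = X - {j} \<union> {i}" by (simp add: shift_def)
      ultimately show ?thesis by (metis DiffD1)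
    qed
    obtain i j X where ij: "i \<in> {1..n}" "i < j" "j \<in> X"
      and moved: "X \<in> \<A> \<and> shift i j X \<notin> \<A> \<or> X \<in> \<B> \<and> shift i j X \<notin> \<B>"
      using False witness[of \<A>] witness[of \<B>] by blast
    have "j \<in> {1..n}"
      using moved ij less.prems G.F_sub H.F_sub by blast
    note ij = ij this
    let ?A = "compress_member i j \<A> ` \<A>" and ?B = "compress_member i j \<B> ` \<B>"
    have le: "(\<Sum>X\<in>?A. \<Sum>X) \<le> (\<Sum>X\<in>\<A>. \<Sum>X)" "(\<Sum>X\<in>?B. \<Sum>X) \<le> (\<Sum>X\<in>\<B>. \<Sum>X)"
      using G.total_compress(1)[of \<A> i j] H.total_compress(1)[of \<B> i j] less.prems ij by auto
    have "(\<Sum>X\<in>?A. \<Sum>X) < (\<Sum>X\<in>\<A>. \<Sum>X) \<or> (\<Sum>X\<in>?B. \<Sum>X) < (\<Sum>X\<in>\<B>. \<Sum>X)"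
      using G.total_compress(2)[of \<A> i j X] H.total_compress(2)[of \<B> i j X] less.prems ij moved
      by blast
    then have lt: "(\<Sum>X\<in>?A. \<Sum>X) + (\<Sum>X\<in>?B. \<Sum>X) < (\<Sum>X\<in>\<A>. \<Sum>X) + (\<Sum>X\<in>\<B>. \<Sum>X)"
      using le by linarith
    have sub: "?A \<subseteq> G" "?B \<subseteq> H"
      using G.compress_member_mem[of \<A> _ i j] H.compress_member_mem[of \<B> _ i j] less.prems ij
      by auto
    have "cross_intersecting t ?A ?B"
      unfolding cross_intersecting_def
    proof clarify
      fix P Q assume "P \<in> \<A>" "Q \<in> \<B>"
      then show "t \<le> card (compress_member i j \<A> P \<inter> compress_member i j \<B> Q)"
        using ij less.prems G.finite_member H.finite_member
        by (intro card_Int_compress_member) auto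
    qed
    then obtain \<A>' \<B>' where AB': "\<A>' \<subseteq> G" "\<B>' \<subseteq> H" "cross_intersecting t \<A>' \<B>'"
      "compressed n \<A>'" "compressed n \<B>'" "sum g ?A \<le> sum g \<A>'" "sum h ?B \<le> sum h \<B>'"
      and pull: "\<forall>S. card S = t \<longrightarrow> S \<in> \<A>' \<longrightarrow> S \<in> \<B>' \<longrightarrow> (\<exists>S'. card S' = t \<and> S' \<in> ?A \<and> S' \<in> ?B)"
      using less.hyps[OF lt sub] by auto
    have "sum g \<A> \<le> sum g \<A>'" "sum h \<B> \<le> sum h \<B>'"
      using G.sum_compress[of \<A> i j] H.sum_compress[of \<B> i j] less.prems ij AB' by linarith+
    moreover have "\<forall>S. card S = t \<longrightarrow> S \<in> \<A>' \<longrightarrow> S \<in> \<B>' \<longrightarrow>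
        (\<exists>S'. card S' = t \<and> S' \<in> \<A> \<and> S' \<in> \<B>)"
      using pull common_member_compress[OF less.prems(3)] ij(2) by (metis less_irrefl)
    ultimately show ?thesis using AB' by blast
  qed
qed

end

section \<open>Tight pairs and the exchange\<close>

text \<open>The members of \<open>\<A>\<close> of trace size \<open>i\<close> on \<open>[p]\<close> that belong to a tight pair, that is, that would
  violate the intersection condition within \<open>[p]\<close> once \<open>p\<close> is deleted.\<close>
definition critical :: "nat \<Rightarrow> nat \<Rightarrow> nat set set \<Rightarrow> nat set set \<Rightarrow> nat \<Rightarrow> nat set set" where
  "critical t p \<A> \<B> i = {X \<in> \<A>. p \<in> X \<and> card (X \<inter> {1..p}) = i \<and>
     (\<exists>Y\<in>\<B>. p \<in> Y \<and> card (X \<inter> Y \<inter> {1..p}) = t)}"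

text \<open>A compressed pair of largest product, with a level \<open>p > t\<close> at which tight pairs occur.\<close>
locale critical_level = weighted_pair +
  fixes \<A> \<B> :: "nat set set" and p :: nat
  assumes A_sub: "\<A> \<subseteq> G" and B_sub: "\<B> \<subseteq> H"
    and A_comp: "compressed n \<A>" and B_comp: "compressed n \<B>"
    and t_less_p: "t < p"
    and within: "\<lbrakk>X \<in> \<A>; Y \<in> \<B>\<rbrakk> \<Longrightarrow> t \<le> card (X \<inter> Y \<inter> {1..p})"
    and tight: "\<exists>X\<in>\<A>. \<exists>Y\<in>\<B>. p \<in> X \<and> p \<in> Y \<and> card (X \<inter> Y \<inter> {1..p}) = t"
    and extremal: "\<lbrakk>\<A>' \<subseteq> G; \<B>' \<subseteq> H; cross_intersecting t \<A>' \<B>'\<rbrakk>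
      \<Longrightarrow> sum g \<A>' * sum h \<B>' \<le> sum g \<A> * sum h \<B>"
begin

lemma swap_level: "critical_level n t c H h G g \<B> \<A> p"
proof (rule critical_level.intro[OF swap], unfold_locales)
  show "\<B> \<subseteq> H" "\<A> \<subseteq> G" "compressed n \<B>" "compressed n \<A>" "t < p"
    using A_sub B_sub A_comp B_comp t_less_p by auto
  show "t \<le> card (X \<inter> Y \<inter> {1..p})" if "X \<in> \<B>" "Y \<in> \<A>" for X Y
    using within[OF that(2,1)] by (simp add: Int_commute)
  show "\<exists>X\<in>\<B>. \<exists>Y\<in>\<A>. p \<in> X \<and> p \<in> Y \<and> card (X \<inter> Y \<inter> {1..p}) = t"
    using tight by (metis Int_commute)
  show "sum h \<A>' * sum g \<B>' \<le> sum h \<B> * sum g \<A>"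
    if "\<A>' \<subseteq> H" "\<B>' \<subseteq> G" "cross_intersecting t \<A>' \<B>'" for \<A>' \<B>'
    using extremal[OF that(2,1) cross_intersecting_sym[OF that(3)]] by (simp add: mult.commute)
qed

lemma p_le_n: "p \<le> n"
  using tight A_sub G.F_sub by fastforce

lemma A_shift: "\<lbrakk>X \<in> \<A>; j \<in> X; i \<in> {1..p}; i \<notin> X; i < j\<rbrakk> \<Longrightarrow> insert i (X - {j}) \<in> \<A>"
  using compressedD[OF A_comp, of X j i] p_le_n by auto

text \<open>An element of \<open>[p]\<close> outside both sets could replace \<open>p\<close> in one of them, which would
  destroy an element of the already tight intersection.\<close>
lemma critical_cover:
  assumes X: "X \<in> \<A>" "p \<in> X" and Y: "Y \<in> \<B>" "p \<in> Y" and tight: "card (X \<inter> Y \<inter> {1..p}) = t"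
  shows "{1..p} \<subseteq> X \<union> Y"
proof
  fix q assume q: "q \<in> {1..p}"
  show "q \<in> X \<union> Y"
  proof (rule ccontr)
    assume out: "q \<notin> X \<union> Y"
    then have "q < p" using q X by (cases "q = p") auto
    then have "insert q (X - {p}) \<in> \<A>" using A_shift[of X p q] X q out by auto
    then have "t \<le> card (insert q (X - {p}) \<inter> Y \<inter> {1..p})" using within Y by blast
    also have "insert q (X - {p}) \<inter> Y \<inter> {1..p} = X \<inter> Y \<inter> {1..p} - {p}" using out by auto
    also have "card \<dots> < card (X \<inter> Y \<inter> {1..p})"
      by (rule card_Diff1_less) (use X Y t_less_p in auto)
    finally show False using tight by simp
  qed
qed

lemma critical_card:
  assumes X: "X \<in> \<A>" "p \<in> X" and Y: "Y \<in> \<B>" "p \<in> Y" and tight: "card (X \<inter> Y \<inter> {1..p}) = t"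
  shows "card (X \<inter> {1..p}) + card (Y \<inter> {1..p}) = p + t"
proof -
  have union: "(X \<inter> {1..p}) \<union> (Y \<inter> {1..p}) = {1..p}" using critical_cover[OF assms] by blast
  have inter: "(X \<inter> {1..p}) \<inter> (Y \<inter> {1..p}) = X \<inter> Y \<inter> {1..p}" by blast
  have "card (X \<inter> {1..p}) + card (Y \<inter> {1..p}) = card {1..p} + card (X \<inter> Y \<inter> {1..p})"
    using card_Un_Int[of "X \<inter> {1..p}" "Y \<inter> {1..p}", unfolded union inter] by blast
  then show ?thesis using tight by simp
qed

lemma critical_sub: "critical t p \<A> \<B> i \<subseteq> \<A>"
  unfolding critical_def by (rule Collect_restrict)

text \<open>The second half of the exchange.\<close>
definition lowered :: "nat \<Rightarrow> nat set set" where
  "lowered j = \<B> \<union> (\<lambda>Y. Y - {p}) ` critical t p \<B> \<A> j"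

lemma lowered_sub: "lowered j \<subseteq> H"
proof
  fix Z assume "Z \<in> lowered j"
  then show "Z \<in> H"
    unfolding lowered_def
  proof
    assume "Z \<in> (\<lambda>Y. Y - {p}) ` critical t p \<B> \<A> j"
    then obtain Y where "Y \<in> \<B>" "Z = Y - {p}" unfolding critical_def by blast
    then show "Z \<in> H" using B_sub H.subset_mem[of Y Z] by blast
  qed (use B_sub in blast)
qed

text \<open>Deleting \<open>p\<close> from a set \<open>Y\<close> of trace size \<open>j\<close> is harmful only for its partners in tight pairs, and
  these have trace size \<open>i = p + t - j\<close>, so they have all been discarded.\<close>
lemma cross_lowered:
  assumes ij: "i + j = p + t"
  shows "cross_intersecting t (\<A> - critical t p \<A> \<B> i) (lowered j)"
  unfolding cross_intersecting_def
proof (intro ballI)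
  fix X Z assume X: "X \<in> \<A> - critical t p \<A> \<B> i" and Z: "Z \<in> lowered j"
  have fin: "finite X" using X A_sub G.finite_member by blast
  have le: "card (X \<inter> Z \<inter> {1..p}) \<le> card (X \<inter> Z)"
    using fin by (intro card_mono) auto
  have "t \<le> card (X \<inter> Z \<inter> {1..p})"
  proof (cases "Z \<in> \<B>")
    case True
    then show ?thesis using X within by blast
  next
    case False
    then obtain Y where Y: "Y \<in> critical t p \<B> \<A> j" "Z = Y - {p}"
      using Z by (auto simp: lowered_def)
    then have YB: "Y \<in> \<B>" "p \<in> Y" "card (Y \<inter> {1..p}) = j" by (auto simp: critical_def)
    have Zeq: "X \<inter> Z \<inter> {1..p} = X \<inter> Y \<inter> {1..p} - {p}" using Y by auto
    have t_le: "t \<le> card (X \<inter> Y \<inter> {1..p})" using X YB within by blast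
    show ?thesis
    proof (cases "p \<in> X")
      case True
      have "card (X \<inter> Y \<inter> {1..p}) \<noteq> t"
      proof
        assume eq: "card (X \<inter> Y \<inter> {1..p}) = t"
        then have "card (X \<inter> {1..p}) = i"
          using critical_card[of X Y] X YB True ij by auto
        then show False using X YB True eq by (auto simp: critical_def)
      qed
      then show ?thesis unfolding Zeq using t_le True YB t_less_p by (simp add: card_Diff_singleton)
    next
      case False
      then show ?thesis unfolding Zeq using t_le by simp
    qed
  qed
  then show "t \<le> card (X \<inter> Z)" using le by linarith
qed

text \<open>The sets \<open>Y - {p}\<close> are new, since they meet a partner of \<open>Y\<close> in only \<open>t - 1\<close> elements of \<open>[p]\<close>.
  As \<open>j > t\<close>, they still have at least \<open>t\<close> elements, so (a) applies.\<close>
lemma sum_lowered: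
  assumes "t < j"
  shows "sum h \<B> + c * sum h (critical t p \<B> \<A> j) \<le> sum h (lowered j)"
proof -
  let ?C = "critical t p \<B> \<A> j"
  have C: "Y \<in> \<B>" "p \<in> Y" "card (Y \<inter> {1..p}) = j" "Y \<in> H" if "Y \<in> ?C" for Y
    using that B_sub by (auto simp: critical_def)
  have inj: "inj_on (\<lambda>Y. Y - {p}) ?C"
    by (rule inj_onI) (use C(2) in blast)
  have new: "(\<lambda>Y. Y - {p}) ` ?C \<inter> \<B> = {}"
  proof -
    have False if Y: "Y \<in> ?C" and YB: "Y - {p} \<in> \<B>" for Y
    proof -
      obtain X where X: "X \<in> \<A>" "p \<in> X" "card (X \<inter> Y \<inter> {1..p}) = t"
        using Y by (auto simp: critical_def Int_commute Int_left_commute)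
      have "card (X \<inter> Y \<inter> {1..p} - {p}) < card (X \<inter> Y \<inter> {1..p})"
        by (rule card_Diff1_less) (use X C[OF Y] t_less_p in auto)
      moreover have "X \<inter> Y \<inter> {1..p} - {p} = X \<inter> (Y - {p}) \<inter> {1..p}" by blast
      ultimately have "card (X \<inter> (Y - {p}) \<inter> {1..p}) < t" using X(3) by simp
      then show False using within[OF X(1) YB] by simp
    qed
    then show ?thesis by blast
  qed
  have "c * h Y \<le> h (Y - {p})" if Y: "Y \<in> ?C" for Y
  proof (rule H.w_drop)
    show "Y \<in> H" "Y - {p} \<in> H" "Y - {p} \<subset> Y"
      using C[OF Y] H.subset_mem[of Y "Y - {p}"] by auto
    have "j \<le> card Y"
      unfolding C(3)[OF Y, symmetric]
      using C(4)[OF Y] H.finite_member by (intro card_mono) auto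
    then show "t \<le> card (Y - {p})"
      using assms C[OF Y] by (simp add: card_Diff_singleton)
  qed
  then have "c * sum h ?C \<le> (\<Sum>Y\<in>?C. h (Y - {p}))"
    unfolding sum_distrib_left by (rule sum_mono)
  also have "\<dots> = sum h ((\<lambda>Y. Y - {p}) ` ?C)" by (simp add: sum.reindex[OF inj])
  also have "sum h \<B> + \<dots> = sum h (lowered j)"
    unfolding lowered_def
    by (rule H.sum_Un_disjoint[symmetric])
      (use lowered_sub[of j] new in \<open>auto simp: lowered_def\<close>)
  finally show ?thesis by simp
qed

lemma sum_remove_critical:
  "sum g (\<A> - critical t p \<A> \<B> i) = sum g \<A> - sum g (critical t p \<A> \<B> i)"
  by (rule sum_diff) (use critical_sub A_sub G.finite_F finite_subset in auto)

lemma product_lowered: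
  assumes "i + j = p + t"
  shows "(sum g \<A> - sum g (critical t p \<A> \<B> i)) * sum h (lowered j) \<le> sum g \<A> * sum h \<B>"
proof -
  have "\<A> - critical t p \<A> \<B> i \<subseteq> G" using A_sub by auto
  then show ?thesis
    using extremal[OF _ lowered_sub cross_lowered[OF assms]] sum_remove_critical[of i] by simp
qed

lemma critical_sum_le: "sum g (critical t p \<A> \<B> i) \<le> sum g \<A>"
  using critical_sub A_sub by (rule G.sum_mono_subset)

lemma trade_off:
  assumes "i + j = p + t" "t < j"
  shows "(sum g \<A> - sum g (critical t p \<A> \<B> i)) * (sum h \<B> + c * sum h (critical t p \<B> \<A> j))
    \<le> sum g \<A> * sum h \<B>"
  using product_lowered[OF assms(1)]
    mult_left_mono[OF sum_lowered[OF assms(2)],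
      of "sum g \<A> - sum g (critical t p \<A> \<B> i)"] critical_sum_le[of i]
  by linarith

text \<open>Replace \<open>p\<close> in a critical set by each of its \<open>p - i\<close> missing elements of \<open>[p]\<close>. By (b) no weight
  is lost, and the new sets lie in \<open>\<A>\<close>, avoid \<open>p\<close>, and arise at most \<open>i\<close> times each, once for each
  element that may have been inserted. So \<open>p - i\<close> times the critical weight is at most \<open>i\<close> times
  the remaining weight.\<close>
lemma critical_share: "real p * sum g (critical t p \<A> \<B> i) \<le> real i * sum g \<A>"
proof (cases "critical t p \<A> \<B> i = {}")
  case True
  then show ?thesis using G.sum_w_nonneg[OF A_sub] by simp
next
  case False
  let ?C = "critical t p \<A> \<B> i"
  let ?D = "{Z \<in> \<A> - ?C. card (Z \<inter> {1..p}) = i}"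
  let ?P = "SIGMA X:?C. {1..p} - X" and ?Q = "SIGMA Z:?D. Z \<inter> {1..p}"
  let ?\<phi> = "\<lambda>(X, q). (insert q (X - {p}), q)"
  have C: "X \<in> \<A>" "p \<in> X" "card (X \<inter> {1..p}) = i" "X \<in> G" if "X \<in> ?C" for X
    using that A_sub by (auto simp: critical_def)
  have finC: "finite ?C" using critical_sub A_sub G.finite_F finite_subset by metis
  have finD: "finite ?D" using A_sub G.finite_F finite_subset by fastforce
  have i_le: "i \<le> p"
    using False C(3) card_mono[of "{1..p}"] by fastforce
  have gap: "card ({1..p} - X) = p - i" if "X \<in> ?C" for X
    using C(3)[OF that] card_Diff_subset_Int[of "{1..p}" X] by (simp add: Int_commute)
  have new: "q < p" "q \<notin> X" "q \<in> {1..p}" "insert q (X - {p}) \<in> ?D"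
      "g X \<le> g (insert q (X - {p}))"
    if "X \<in> ?C" "q \<in> {1..p} - X" for X q
  proof -
    show q: "q < p" "q \<notin> X" "q \<in> {1..p}" using that C(2)[of X] by (auto simp: le_less)
    have "insert q (X - {p}) \<inter> {1..p} = insert q (X \<inter> {1..p} - {p})" using q by auto
    then have "card (insert q (X - {p}) \<inter> {1..p}) = i"
      using card_insert_Diff_same[of "X \<inter> {1..p}" p q] C[OF that(1)] q t_less_p by auto
    then show "insert q (X - {p}) \<in> ?D"
      using A_shift[of X p q] C[OF that(1)] q by (auto simp: critical_def)
    show "g X \<le> g (insert q (X - {p}))"
      using G.w_insert_Diff(2)[of X p q] C[OF that(1)] q by auto
  qed
  have inj: "inj_on ?\<phi> ?P"
  proof (rule inj_onI)
    fix x y assume x: "x \<in> ?P" and y: "y \<in> ?P" and eq: "?\<phi> x = ?\<phi> y"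
    obtain X q where xq: "x = (X, q)" by (cases x)
    obtain Y r where yr: "y = (Y, r)" by (cases y)
    have same: "insert q (X - {p}) = insert q (Y - {p})" "q = r" using eq xq yr by auto
    have "p \<in> X" "p \<in> Y" "q \<notin> X" "q \<notin> Y" using x y xq yr C(2) \<open>q = r\<close> by auto
    then have "insert p (insert q (X - {p}) - {q}) = X" "insert p (insert q (Y - {p}) - {q}) = Y"
      by auto
    then have "X = Y" using same(1) by metis
    then show "x = y" using xq yr \<open>q = r\<close> by simp
  qed
  have "real (p - i) * sum g ?C = (\<Sum>X\<in>?C. \<Sum>q\<in>{1..p} - X. g X)"
    by (simp add: sum_distrib_left gap del: One_nat_def)
  also have "\<dots> \<le> (\<Sum>X\<in>?C. \<Sum>q\<in>{1..p} - X. g (insert q (X - {p})))"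
    by (intro sum_mono new(5))
  also have "\<dots> = (\<Sum>x\<in>?P. g (fst (?\<phi> x)))"
    using finC by (subst sum.Sigma) (auto simp: split_def)
  also have "\<dots> = (\<Sum>z\<in>?\<phi> ` ?P. g (fst z))"
    by (simp add: sum.reindex[OF inj] del: One_nat_def)
  also have "\<dots> \<le> (\<Sum>z\<in>?Q. g (fst z))"
  proof (rule sum_mono2)
    show "finite ?Q" using finD by auto
    show "?\<phi> ` ?P \<subseteq> ?Q" using new(3,4) by auto
    show "0 \<le> g (fst b)" if "b \<in> ?Q - ?\<phi> ` ?P" for b
    proof -
      have "fst b \<in> G" using that A_sub by auto
      then show ?thesis using less_imp_le[OF G.w_pos] by blast
    qed
  qed
  also have "\<dots> = (\<Sum>Z\<in>?D. \<Sum>q\<in>Z \<inter> {1..p}. g Z)"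
    using finD by (subst sum.Sigma) (auto simp: split_def)
  also have "\<dots> = real i * sum g ?D"
    by (simp add: sum_distrib_left)
  also have "\<dots> \<le> real i * sum g (\<A> - ?C)"
    using A_sub by (intro mult_left_mono G.sum_mono_subset) auto
  finally show ?thesis
    using sum_remove_critical[of i] i_le by (simp add: of_nat_diff algebra_simps)
qed

lemma tight_size_ge:
  assumes "X \<in> \<A>" shows "t \<le> card (X \<inter> {1..p})"
proof -
  obtain Y where "Y \<in> \<B>" using tight by blast
  then have "t \<le> card (X \<inter> Y \<inter> {1..p})" using assms within by blast
  also have "\<dots> \<le> card (X \<inter> {1..p})" by (intro card_mono) auto
  finally show ?thesis .
qed

lemma sums_pos: "0 < sum g \<A>" "0 < sum h \<B>"
  using tight G.sum_w_pos[OF A_sub] H.sum_w_pos[OF B_sub] by blast+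

section \<open>Tight pairs with a trace of size \<open>t\<close>\<close>

text \<open>If a trace \<open>S\<close> has only \<open>t\<close> elements, every \<open>Y \<in> \<B>\<close> contains it. Shifting \<open>p \<in> S\<close> to any missing
  element produces another such trace, so \<open>Y\<close> contains all of \<open>[p]\<close>.\<close>
lemma critical_all:
  assumes "critical t p \<A> \<B> t \<noteq> {}"
  shows "critical t p \<B> \<A> p = \<B>" and "Y \<in> \<B> \<Longrightarrow> {1..p} \<subseteq> Y"
proof -
  obtain X where X: "X \<in> \<A>" "p \<in> X" "card (X \<inter> {1..p}) = t"
    using assms by (auto simp: critical_def)
  have trace: "Z \<inter> {1..p} \<subseteq> Y" if "Z \<in> \<A>" "card (Z \<inter> {1..p}) = t" "Y \<in> \<B>" for Z Y
  proof -
    have "Z \<inter> Y \<inter> {1..p} = Z \<inter> {1..p}"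
    proof (rule card_seteq)
      show "card (Z \<inter> {1..p}) \<le> card (Z \<inter> Y \<inter> {1..p})" using within that by metis
    qed auto
    then show ?thesis by blast
  qed
  have all: "{1..p} \<subseteq> Y" if Y: "Y \<in> \<B>" for Y
  proof
    fix q assume q: "q \<in> {1..p}"
    show "q \<in> Y"
    proof (cases "q \<in> X")
      case True
      then show ?thesis using trace[OF X(1,3) Y] q by blast
    next
      case False
      then have "q < p" using q X by (cases "q = p") auto
      then have "insert q (X - {p}) \<in> \<A>" using A_shift X q False by blast
      moreover have "insert q (X - {p}) \<inter> {1..p} = insert q (X \<inter> {1..p} - {p})" using q by blast
      moreover have "card (insert q (X \<inter> {1..p} - {p})) = t"
        unfolding X(3)[symmetric] using X False t_less_p by (intro card_insert_Diff_same) auto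
      ultimately have "insert q (X - {p}) \<inter> {1..p} \<subseteq> Y" using trace Y by metis
      then show ?thesis using q by blast
    qed
  qed
  then show "Y \<in> \<B> \<Longrightarrow> {1..p} \<subseteq> Y" .
  show "critical t p \<B> \<A> p = \<B>"
  proof
    show "\<B> \<subseteq> critical t p \<B> \<A> p"
    proof
      fix Y assume Y: "Y \<in> \<B>"
      have "Y \<inter> {1..p} = {1..p}" using all[OF Y] by blast
      moreover have "Y \<inter> X \<inter> {1..p} = X \<inter> {1..p}" using all[OF Y] by blast
      moreover have "p \<in> Y" using all[OF Y] t_less_p by auto
      ultimately show "Y \<in> critical t p \<B> \<A> p"
        using X Y unfolding critical_def by auto
    qed
  qed (auto simp: critical_def)
qed

text \<open>With \<open>\<beta> = p - t\<close>, the exchange and \<open>critical_share\<close> give \<open>(\<beta> / p) (1 + c) \<le> 1\<close>, that is,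
  \<open>\<beta> c \<le> t\<close>. As \<open>c \<ge> t\<close>, only \<open>\<beta> = 1\<close> and \<open>c = t\<close> survive. Then the exchange does not lower the
  product and moves both families into their stars.\<close>
lemma bound_if_critical_t:
  assumes ne: "critical t p \<A> \<B> t \<noteq> {}"
  shows "sum g \<A> * sum h \<B> \<le> sum g G.star * sum h H.star \<and> \<not> real t < c"
proof -
  let ?a = "sum g \<A>" and ?b = "sum h \<B>" and ?r = "sum g \<A> - sum g (critical t p \<A> \<B> t)"
  have r: "0 \<le> ?r" using critical_sum_le[of t] by simp
  have "?r * (?b + c * ?b) \<le> ?a * ?b"
    using trade_off[of t p] critical_all(1)[OF ne] t_less_p by simp
  then have "(?r * (1 + c)) * ?b \<le> ?a * ?b" by (simp add: algebra_simps)
  then have le_a: "?r * (1 + c) \<le> ?a" using sums_pos by simp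
  have share: "(real p - real t) * ?a \<le> real p * ?r"
    using critical_share[of t] by (simp add: algebra_simps)
  have "((real p - real t) * (1 + c)) * ?a \<le> real p * (?r * (1 + c))"
    using mult_right_mono[OF share, of "1 + c"] G.c_pos by (simp add: algebra_simps)
  also have "\<dots> \<le> real p * ?a" using le_a by (intro mult_left_mono) auto
  finally have "(real p - real t) * (1 + c) \<le> real p" using sums_pos by simp
  then have excess: "(real p - real t) * c \<le> real t" by (simp add: algebra_simps)
  have diff: "1 \<le> real p - real t" using t_less_p by simp
  then have "1 * c \<le> (real p - real t) * c" using G.c_pos by (intro mult_right_mono) auto
  then have c: "c = real t" using excess G.c_ge by linarith
  then have "(real p - real t) * c \<le> 1 * c" using excess by simp
  then have p: "p = t + 1" using diff G.c_pos by simp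
  have "?a * ?b \<le> ?r * sum h (lowered p)"
  proof -
    have "?a \<le> ?r * (1 + c)" using share p c by (simp add: algebra_simps)
    then have "?a * ?b \<le> (?r * (1 + c)) * ?b" using sums_pos by (intro mult_right_mono) auto
    also have "\<dots> = ?r * (?b + c * ?b)" by (simp add: algebra_simps)
    also have "\<dots> \<le> ?r * sum h (lowered p)"
      using sum_lowered[of p] critical_all(1)[OF ne] t_less_p r by (intro mult_left_mono) auto
    finally show ?thesis .
  qed
  also have "\<dots> \<le> sum g G.star * sum h H.star"
  proof (rule mult_mono)
    have "\<A> - critical t p \<A> \<B> t \<subseteq> G.star"
    proof
      fix X assume X: "X \<in> \<A> - critical t p \<A> \<B> t"
      obtain Y where Y: "Y \<in> \<B>" using tight by blast
      have "{1..t} \<subseteq> X"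
      proof (rule ccontr)
        assume "\<not> {1..t} \<subseteq> X"
        then obtain q where q: "q \<in> {1..t}" "q \<notin> X" by blast
        have trace: "X \<inter> {1..p} = {1..p} - {q}"
        proof (rule card_seteq)
          show "card ({1..p} - {q}) \<le> card (X \<inter> {1..p})"
            using tight_size_ge[of X] X q p by (simp add: card_Diff_singleton)
        qed (use q in auto)
        have "card ({1..p} - {q}) = t" "p \<in> {1..p} - {q}"
          using q p by (auto simp: card_Diff_singleton)
        then have card_X: "card (X \<inter> {1..p}) = t" and p_X: "p \<in> X"
          using trace by (simp only:, blast)
        have "X \<inter> Y \<inter> {1..p} = X \<inter> {1..p}" "p \<in> Y"
          using critical_all(2)[OF ne Y] p by auto
        then have "card (X \<inter> Y \<inter> {1..p}) = t" "p \<in> Y" using card_X by (simp only:)+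
        then have "X \<in> critical t p \<A> \<B> t"
          using X Y card_X p_X unfolding critical_def by blast
        then show False using X by blast
      qed
      then show "X \<in> G.star" using X A_sub by (auto simp: G.star_def members_containing_def)
    qed
    then show "?r \<le> sum g G.star"
      unfolding sum_remove_critical[symmetric] using G.star_sub by (rule G.sum_mono_subset)
    have "lowered p \<subseteq> H.star"
    proof
      fix Z assume Z: "Z \<in> lowered p"
      then obtain Y where Y: "Y \<in> \<B>" "Z = Y \<or> Z = Y - {p}"
        unfolding lowered_def critical_def by blast
      have "{1..t} \<subseteq> Z" using critical_all(2)[OF ne Y(1)] Y(2) p by auto
      then show "Z \<in> H.star"
        using Z lowered_sub[of p] by (auto simp: H.star_def members_containing_def)
    qed
    then show "sum h (lowered p) \<le> sum h H.star"
      using H.star_sub by (rule H.sum_mono_subset)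
    show "0 \<le> sum g G.star" "0 \<le> sum h (lowered p)"
      using G.sum_w_nonneg[OF G.star_sub] H.sum_w_nonneg[OF lowered_sub] by auto
  qed
  finally show ?thesis using c by simp
qed

end

section \<open>Unbalanced trace sizes\<close>

text \<open>The trace sizes are \<open>t + \<alpha>\<close> and \<open>t + \<beta>\<close>, so \<open>p = t + \<alpha> + \<beta>\<close>. Multiplying the two exchange
  inequalities gives \<open>c\<^sup>2 (1 - x) (1 - y) \<le> 1\<close>. Here \<open>1 - x \<ge> \<beta> / p\<close>, and the first of them turns
  this into \<open>y \<le> (t + \<alpha>) / (c \<beta>)\<close>, so that \<open>c (c \<beta> - t - \<alpha>) \<le> p\<close>. This is least restrictive at
  \<open>\<alpha> = \<beta> = 2\<close>, where it reads \<open>c (2 c - 2 - t) \<le> t + 4\<close> and fails for \<open>c > 2 (t + 3) / 3\<close>.\<close>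
lemma unbalanced_shares_impossible:
  fixes x y c t \<alpha> \<beta> :: real
  assumes t: "1 \<le> t" and c: "2 * t + 6 < 3 * c"
    and \<alpha>: "1 \<le> \<alpha>" "\<alpha> \<le> \<beta>" and \<beta>: "2 \<le> \<beta>"
    and x: "0 < x" and y: "0 < y" and share: "(t + \<alpha> + \<beta>) * x \<le> t + \<alpha>"
    and xy: "c * y * (1 - x) \<le> x" and yx: "c * x * (1 - y) \<le> y"
  shows False
proof -
  let ?p = "t + \<alpha> + \<beta>"
  have c3: "8 < 3 * c" using t c by simp
  have co: "\<beta> \<le> ?p * (1 - x)" using share by (simp add: algebra_simps)
  \<comment> \<open>The first exchange makes \<open>y\<close> small.\<close>
  have "c * y * \<beta> \<le> c * y * (?p * (1 - x))"
    using co y c3 by (intro mult_left_mono) auto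
  also have "\<dots> = ?p * (c * y * (1 - x))" by (simp add: algebra_simps)
  also have "\<dots> \<le> ?p * x" using xy t \<alpha> \<beta> by (intro mult_left_mono) auto
  finally have y_small: "c * \<beta> * y \<le> t + \<alpha>" using share by (simp add: algebra_simps)
  have "(c * x * (1 - y)) * (c * (1 - x)) \<le> y * (c * (1 - x))"
  proof (rule mult_right_mono[OF yx])
    have "0 \<le> ?p * (1 - x)" using co \<beta> by linarith
    then have "0 \<le> 1 - x" using t \<alpha> \<beta> by (simp add: zero_le_mult_iff)
    then show "0 \<le> c * (1 - x)" using c3 by simp
  qed
  also have "\<dots> \<le> x" using xy by (simp add: algebra_simps)
  finally have "(c * (1 - y)) * (c * (1 - x)) * x \<le> 1 * x" by (simp add: algebra_simps)
  then have prod: "(c * (1 - y)) * (c * (1 - x)) \<le> 1" using x by simp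
  \<comment> \<open>Both exchanges together bound \<open>c\<close>.\<close>
  have gap: "c * \<beta> - t - \<alpha> \<le> \<beta> * (c * (1 - y))" using y_small by (simp add: algebra_simps)
  have pos: "(t + 2) / 3 \<le> c * \<beta> - t - \<alpha>"
  proof -
    have "(c - 1) * 2 \<le> (c - 1) * \<beta>" using \<beta> c3 by (intro mult_left_mono) auto
    then have "2 * c - 2 \<le> c * \<beta> - \<alpha>" using \<alpha> by (simp add: algebra_simps)
    then show ?thesis using c by simp
  qed
  have "0 < (t + 2) / 3" using t by simp
  then have "0 < \<beta> * (c * (1 - y))" using pos gap by (meson less_le_trans)
  then have "0 < c * (1 - y)" by (rule zero_less_mult_pos) (use \<beta> in simp)
  then have ymax: "0 \<le> c * (1 - y)" by simp
  have "c * (c * \<beta> - t - \<alpha>) \<le> c * (\<beta> * (c * (1 - y)))"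
    using gap c3 by (intro mult_left_mono) auto
  also have "\<dots> = (c * (1 - y)) * c * \<beta>" by (simp add: algebra_simps)
  also have "\<dots> \<le> (c * (1 - y)) * c * (?p * (1 - x))"
    using co ymax c3 by (intro mult_left_mono) auto
  also have "\<dots> = ?p * ((c * (1 - y)) * (c * (1 - x)))" by (simp add: algebra_simps)
  also have "\<dots> \<le> ?p * 1" using prod t \<alpha> \<beta> by (intro mult_left_mono) auto
  finally have bound: "c * (c * \<beta> - t - \<alpha>) \<le> t + \<alpha> + \<beta>" by simp
  \<comment> \<open>Reduction to \<open>\<alpha> = \<beta> = 2\<close>: first raise \<open>\<alpha>\<close> to \<open>\<beta>\<close>, then lower \<open>\<beta>\<close> to \<open>2\<close>.\<close>
  have "(c * (c - 1) - 2) * 2 \<le> (c * (c - 1) - 2) * \<beta>"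
  proof (rule mult_left_mono[OF \<beta>])
    have "2 * 1 \<le> c * (c - 1)" using c3 by (intro mult_mono) auto
    then show "0 \<le> c * (c - 1) - 2" by simp
  qed
  moreover have "(c + 1) * \<alpha> \<le> (c + 1) * \<beta>" using \<alpha> c3 by (intro mult_left_mono) auto
  ultimately have "c * (2 * c - 2 - t) \<le> t + 4" using bound by (simp add: algebra_simps)
  moreover have "(2 * (t + 3) / 3) * ((t + 6) / 3) \<le> c * (2 * c - 2 - t)"
    using c t by (intro mult_mono) auto
  moreover have "0 < t * t" using t by simp
  ultimately show False using t by (simp add: field_simps)
qed

context critical_level
begin

lemma exchange_shares:
  assumes "i + j = p + t" "t < j"
  defines "x \<equiv> sum g (critical t p \<A> \<B> i) / sum g \<A>"
    and "y \<equiv> sum h (critical t p \<B> \<A> j) / sum h \<B>"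
  shows "c * y * (1 - x) \<le> x"
proof -
  let ?a = "sum g \<A>" and ?b = "sum h \<B>"
  have x: "sum g (critical t p \<A> \<B> i) = x * ?a" and y: "sum h (critical t p \<B> \<A> j) = y * ?b"
    using sums_pos by (auto simp: x_def y_def)
  have "(?a - x * ?a) * (?b + c * (y * ?b)) \<le> ?a * ?b"
    using trade_off[OF assms(1,2)] unfolding x y .
  then have "((1 - x) * (1 + c * y)) * (?a * ?b) \<le> 1 * (?a * ?b)" by (simp add: algebra_simps)
  then have "(1 - x) * (1 + c * y) \<le> 1" using sums_pos by (simp add: mult_le_cancel_right)
  then show ?thesis by (simp add: algebra_simps)
qed

lemma not_unbalanced:
  assumes ij: "i + j = p + t" "t < i" "i \<le> j" "t + 2 \<le> j"
    and X: "critical t p \<A> \<B> i \<noteq> {}" and Y: "critical t p \<B> \<A> j \<noteq> {}"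
  shows False
proof -
  interpret swapped: critical_level n t c H h G g \<B> \<A> p by (rule swap_level)
  define x where "x = sum g (critical t p \<A> \<B> i) / sum g \<A>"
  define y where "y = sum h (critical t p \<B> \<A> j) / sum h \<B>"
  have "0 < sum g (critical t p \<A> \<B> i)" "0 < sum h (critical t p \<B> \<A> j)"
    using X Y G.sum_w_pos[OF subset_trans[OF critical_sub A_sub]]
      H.sum_w_pos[OF subset_trans[OF swapped.critical_sub B_sub]] by blast+
  then have pos: "0 < x" "0 < y" using sums_pos by (simp_all add: x_def y_def)
  have "real i + real j = real p + real t" using ij(1) by (metis of_nat_add)
  then have size: "real t + (real i - real t) + (real j - real t) = real p" by simp
  have share: "real p * x \<le> real i"
    using critical_share[of i] sums_pos by (simp add: x_def divide_le_eq)
  show False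
  proof (rule unbalanced_shares_impossible[OF _ G.c_gt _ _ _ pos])
    show "1 \<le> real t" "1 \<le> real i - real t" "real i - real t \<le> real j - real t"
      "2 \<le> real j - real t" using ij G.t_pos by auto
    show "(real t + (real i - real t) + (real j - real t)) * x \<le> real t + (real i - real t)"
      unfolding size using share by simp
    show "c * y * (1 - x) \<le> x" unfolding x_def y_def using ij by (intro exchange_shares) auto
    show "c * x * (1 - y) \<le> y" unfolding x_def y_def using ij by (intro swapped.exchange_shares) auto
  qed
qed

section \<open>Balanced trace sizes\<close>

text \<open>A trace of size \<open>t\<close> in \<open>\<A>\<close>, and every trace obtained from it by shifts, is contained in the
  trace of \<open>Y\<close>, which misses only one element \<open>q \<le> t + 1\<close> of \<open>[t + 2]\<close>. No element above \<open>q\<close> can be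
  present, since it could be shifted to \<open>q\<close>; so the trace lies in \<open>[q - 1] \<subseteq> [t]\<close>.\<close>
lemma large_if_not_core:
  assumes X: "X \<in> \<A>" "X \<notin> G.core"
    and Y: "Y \<in> \<B>" "p \<in> Y" "card (Y \<inter> {1..p}) = t + 1" and p: "p = t + 2"
  shows "t + 1 \<le> card (X \<inter> {1..p})"
proof (rule ccontr)
  assume "\<not> t + 1 \<le> card (X \<inter> {1..p})"
  then have X_card: "card (X \<inter> {1..p}) = t" using tight_size_ge[OF X(1)] by simp
  have trace: "Z \<inter> {1..p} \<subseteq> Y" if "Z \<in> \<A>" "card (Z \<inter> {1..p}) = t" for Z
  proof -
    have "Z \<inter> Y \<inter> {1..p} = Z \<inter> {1..p}"
    proof (rule card_seteq)
      show "card (Z \<inter> {1..p}) \<le> card (Z \<inter> Y \<inter> {1..p})" using within that Y by metis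
    qed auto
    then show ?thesis by blast
  qed
  have "\<exists>q. q \<in> {1..p} \<and> q \<notin> Y"
  proof (rule ccontr)
    assume "\<not> ?thesis"
    then have "Y \<inter> {1..p} = {1..p}" by blast
    then show False using Y p by simp
  qed
  then obtain q where q: "q \<in> {1..p}" "q \<notin> Y" by blast
  have below: "s < q" if s: "s \<in> X \<inter> {1..p}" for s
  proof (rule ccontr)
    assume "\<not> s < q"
    moreover have "q \<notin> X" using trace[OF X(1) X_card] q by blast
    ultimately have "q < s" using s by (cases "q = s") auto
    then have "insert q (X - {s}) \<in> \<A>" using A_shift[of X s q] X s q \<open>q \<notin> X\<close> by blast
    moreover have "insert q (X - {s}) \<inter> {1..p} = insert q (X \<inter> {1..p} - {s})" using q by blast
    moreover have "card (insert q (X \<inter> {1..p} - {s})) = t"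
      unfolding X_card[symmetric] using s \<open>q \<notin> X\<close> by (intro card_insert_Diff_same) auto
    ultimately have "insert q (X - {s}) \<inter> {1..p} \<subseteq> Y" using trace by metis
    then show False using q by blast
  qed
  have "q < p" using q Y by (cases "q = p") auto
  then have "X \<inter> {1..p} \<subseteq> {1..t}" using below p by fastforce
  then have "X \<inter> {1..p} = {1..t}" using X_card by (intro card_subset_eq) auto
  then show False using X A_sub p by (auto simp: G.core_def)
qed

lemma defect_of_large:
  assumes p: "p = t + 2" and large: "\<And>X. X \<in> \<A> \<Longrightarrow> X \<notin> G.core \<Longrightarrow> t + 1 \<le> card (X \<inter> {1..p})"
  shows "c * sum g \<A> \<le> c * sum g (\<A> \<inter> G.star) + real t * sum g G.core"
proof -
  let ?D = "{X \<in> G. card (X \<inter> {1..t + 2}) = t + 1 \<and> \<not> {1..t} \<subseteq> X}"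
  have "\<A> - G.star \<subseteq> ?D"
  proof
    fix X assume X: "X \<in> \<A> - G.star"
    then have XG: "X \<in> G" "\<not> {1..t} \<subseteq> X" using A_sub by (auto simp: G.star_def members_containing_def)
    then obtain q where q: "q \<in> {1..t}" "q \<notin> X" by blast
    have "card (X \<inter> {1..p}) \<le> card ({1..p} - {q})" using q by (intro card_mono) auto
    also have "\<dots> = t + 1" using q p by (simp add: card_Diff_singleton)
    finally have "card (X \<inter> {1..p}) = t + 1" using large[of X] X G.core_sub by fastforce
    then show "X \<in> ?D" using XG p by simp
  qed
  then have "sum g (\<A> - G.star) \<le> sum g ?D" by (rule G.sum_mono_subset) auto
  then have "c * sum g (\<A> - G.star) \<le> c * sum g ?D" using G.c_pos by (intro mult_left_mono) auto
  also have "\<dots> \<le> real t * sum g G.core" by (rule G.star_defect)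
  finally have "c * sum g (\<A> - G.star) \<le> real t * sum g G.core" .
  moreover have "sum g \<A> = sum g (\<A> \<inter> G.star) + sum g (\<A> - G.star)"
    using G.sum_Un_disjoint[of "\<A> \<inter> G.star" "\<A> - G.star"] A_sub
    by (metis Diff_disjoint Diff_subset Int_Diff_Un Int_Diff_disjoint inf_le1 order_trans)
  ultimately show ?thesis by (simp add: algebra_simps)
qed

lemma core_free_sum:
  assumes "\<A> \<inter> G.core = {}"
  shows "sum g (\<A> \<inter> G.star) + sum g G.core \<le> sum g G.star"
proof -
  have "sum g (\<A> \<inter> G.star) + sum g G.core = sum g (\<A> \<inter> G.star \<union> G.core)"
    using assms A_sub G.star_sub G.core_sub
    by (intro G.sum_Un_disjoint[symmetric]) auto
  also have "\<dots> \<le> sum g G.star"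
    using G.core_sub G.star_sub by (intro G.sum_mono_subset) auto
  finally show ?thesis .
qed

lemma core_weights_pos: "0 < sum g G.core" "0 < sum h H.core"
proof -
  obtain X Y where XY: "X \<in> \<A>" "Y \<in> \<B>" "card (X \<inter> Y \<inter> {1..p}) = t" using tight by blast
  then have mem: "X \<in> G" "Y \<in> H" using A_sub B_sub by auto
  have "card (X \<inter> Y \<inter> {1..p}) \<le> card X"
    by (rule card_mono) (use G.finite_member[OF mem(1)] in auto)
  then show "0 < sum g G.core" using G.core_pos[OF mem(1)] XY(3) by simp
  have "card (X \<inter> Y \<inter> {1..p}) \<le> card Y"
    by (rule card_mono) (use H.finite_member[OF mem(2)] in auto)
  then show "0 < sum h H.core" using H.core_pos[OF mem(2)] XY(3) by simp
qed

text \<open>Compared with the star, \<open>\<A>\<close> lacks the whole core and has outside the star at most \<open>t / c\<close> times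
  the core.\<close>
lemma sum_le_star_if_core_free:
  assumes p: "p = t + 2" and large: "\<And>X. X \<in> \<A> \<Longrightarrow> X \<notin> G.core \<Longrightarrow> t + 1 \<le> card (X \<inter> {1..p})"
    and free: "\<A> \<inter> G.core = {}"
  shows "sum g \<A> \<le> sum g G.star \<and> (real t < c \<longrightarrow> sum g \<A> < sum g G.star)"
proof -
  have "c * sum g \<A> \<le> c * sum g G.star - (c - real t) * sum g G.core"
    using defect_of_large[OF p large]
      mult_left_mono[OF core_free_sum[OF free], of c] G.c_pos
    by (simp add: algebra_simps)
  moreover have "0 \<le> (c - real t) * sum g G.core" "real t < c \<Longrightarrow> 0 < (c - real t) * sum g G.core"
    using core_weights_pos G.c_ge by auto
  ultimately have "c * sum g \<A> \<le> c * sum g G.star"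
    "real t < c \<Longrightarrow> c * sum g \<A> < c * sum g G.star" by linarith+
  then show ?thesis using G.c_pos by auto
qed

text \<open>A member of trace \<open>[t]\<close> in \<open>\<A>\<close> forces \<open>\<B>\<close> into its star. So \<open>\<A>\<close> exceeds its star at most by the
  factor \<open>1 + t / c\<close>, whereas \<open>\<B>\<close> lacks its core, whose weight is at least \<open>c / 3\<close> times that
  of \<open>\<B>\<close>. The loss wins because \<open>3 t < c\<^sup>2\<close>.\<close>
lemma bound_if_one_core:
  assumes p: "p = t + 2"
    and large: "\<And>X. X \<in> \<A> \<Longrightarrow> X \<notin> G.core \<Longrightarrow> t + 1 \<le> card (X \<inter> {1..p})"
      "\<And>Y. Y \<in> \<B> \<Longrightarrow> Y \<notin> H.core \<Longrightarrow> t + 1 \<le> card (Y \<inter> {1..p})"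
    and meets: "\<A> \<inter> G.core \<noteq> {}" and free: "\<B> \<inter> H.core = {}"
  shows "sum g \<A> * sum h \<B> < sum g G.star * sum h H.star"
proof -
  interpret swapped: critical_level n t c H h G g \<B> \<A> p by (rule swap_level)
  let ?a = "sum g \<A>" and ?b = "sum h \<B>" and ?A = "sum g G.star" and ?B = "sum h H.star"
    and ?k = "sum g G.core" and ?l = "sum h H.core"
  obtain X where X: "X \<in> \<A>" "X \<inter> {1..p} = {1..t}" using meets p by (auto simp: G.core_def)
  have B_star: "\<B> \<subseteq> H.star"
  proof
    fix Y assume Y: "Y \<in> \<B>"
    have "{1..t} \<inter> Y = {1..t}"
    proof (rule card_seteq)
      have "X \<inter> Y \<inter> {1..p} = {1..t} \<inter> Y" using X by blast
      then show "card {1..t} \<le> card ({1..t} \<inter> Y)" using within[OF X(1) Y] by simp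
    qed auto
    then show "Y \<in> H.star" using Y B_sub by (auto simp: H.star_def members_containing_def)
  qed
  have lb: "c * ?b \<le> 3 * ?l"
  proof (rule H.star_upper_part[OF B_star])
    show "t + 1 \<le> card (Y \<inter> {1..t + 2})" if "Y \<in> \<B>" for Y
      using large(2)[OF that] that free p by auto
  qed
  have bB: "?b + ?l \<le> ?B"
    using swapped.core_free_sum[OF free] B_star by (simp add: Int_absorb2)
  have "c * sum g (\<A> \<inter> G.star) \<le> c * ?A"
    using G.star_sub G.c_pos by (intro mult_left_mono G.sum_mono_subset) auto
  moreover have kA: "?k \<le> ?A" using G.core_sub G.star_sub by (rule G.sum_mono_subset)
  then have "real t * ?k \<le> real t * ?A" by (intro mult_left_mono) auto
  ultimately have aA: "c * ?a \<le> (c + real t) * ?A"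
    using defect_of_large[OF p large(1)] by (simp add: algebra_simps)
  have A_pos: "0 < ?A" using kA core_weights_pos by linarith
  have "c * (c * (?a * ?b)) = (c * ?a) * (c * ?b)" by (simp add: algebra_simps)
  also have "\<dots> \<le> ((c + real t) * ?A) * (c * ?b)"
    using aA sums_pos G.c_pos by (intro mult_right_mono) auto
  also have "\<dots> = ?A * (c * c * ?b + real t * (c * ?b))" by (simp add: algebra_simps)
  also have "\<dots> \<le> ?A * (c * c * ?b + real t * (3 * ?l))"
    using lb A_pos by (intro mult_left_mono add_left_mono) auto
  also have "\<dots> < ?A * (c * c * ?b + c * c * ?l)"
  proof -
    \<comment> \<open>\<open>c\<^sup>2 > 4 (t + 3)\<^sup>2 / 9 \<ge> 16 t / 3\<close>, the last step because \<open>(t - 3)\<^sup>2 \<ge> 0\<close>.\<close>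
    have "(2 * (real t + 3) / 3) * (2 * (real t + 3) / 3) \<le> c * c"
      using G.c_gt by (intro mult_mono) auto
    moreover have "0 \<le> (real t - 3) * (real t - 3)" by simp
    moreover have "1 \<le> real t" using G.t_pos by simp
    ultimately have "real t * 3 < c * c" by (simp add: field_simps)
    then have "real t * 3 * ?l < c * c * ?l" using core_weights_pos by (intro mult_strict_right_mono) auto
    then show ?thesis using A_pos by (intro mult_strict_left_mono) (auto simp: algebra_simps)
  qed
  also have "\<dots> = c * (c * (?A * (?b + ?l)))" by (simp add: algebra_simps)
  finally have "?a * ?b < ?A * (?b + ?l)" using G.c_pos by simp
  also have "\<dots> \<le> ?A * ?B" using bB A_pos by (intro mult_left_mono) auto
  finally show ?thesis .
qed

lemma bound_if_balanced:
  assumes p: "p = t + 2"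
    and X: "critical t p \<A> \<B> (t + 1) \<noteq> {}" and Y: "critical t p \<B> \<A> (t + 1) \<noteq> {}"
  shows "sum g \<A> * sum h \<B> \<le> sum g G.star * sum h H.star
    \<and> (real t < c \<longrightarrow> sum g \<A> * sum h \<B> < sum g G.star * sum h H.star)"
proof -
  interpret swapped: critical_level n t c H h G g \<B> \<A> p by (rule swap_level)
  have large: "t + 1 \<le> card (X \<inter> {1..p})" if "X \<in> \<A>" "X \<notin> G.core" for X
    using Y large_if_not_core[OF that _ _ _ p] unfolding critical_def by blast
  have large': "t + 1 \<le> card (Y \<inter> {1..p})" if "Y \<in> \<B>" "Y \<notin> H.core" for Y
    using X swapped.large_if_not_core[OF that _ _ _ p] unfolding critical_def by blast
  consider "\<A> \<inter> G.core = {}" "\<B> \<inter> H.core = {}" | "\<A> \<inter> G.core \<noteq> {}" "\<B> \<inter> H.core = {}"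
    | "\<A> \<inter> G.core = {}" "\<B> \<inter> H.core \<noteq> {}" | "\<A> \<inter> G.core \<noteq> {}" "\<B> \<inter> H.core \<noteq> {}"
    by blast
  then show ?thesis
  proof cases
    case 1
    have le: "sum g \<A> \<le> sum g G.star" "sum h \<B> \<le> sum h H.star"
      and less: "real t < c \<Longrightarrow> sum g \<A> < sum g G.star"
      using sum_le_star_if_core_free[OF p large 1(1)]
        swapped.sum_le_star_if_core_free[OF p large' 1(2)] by blast+
    have "sum g \<A> * sum h \<B> \<le> sum g G.star * sum h \<B>"
      using le sums_pos by (intro mult_right_mono) auto
    moreover have "sum g G.star * sum h \<B> \<le> sum g G.star * sum h H.star"
      using le sums_pos by (intro mult_left_mono) auto
    moreover have "sum g \<A> * sum h \<B> < sum g G.star * sum h \<B>" if "real t < c"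
      using less[OF that] sums_pos by (intro mult_strict_right_mono) auto
    ultimately show ?thesis by fastforce
  next
    case 2
    then show ?thesis using bound_if_one_core[OF p large large'] by auto
  next
    case 3
    then show ?thesis
      using swapped.bound_if_one_core[OF p large' large] by (auto simp: mult.commute)
  next
    case 4
    \<comment> \<open>Each family has a member with trace \<open>[t]\<close>, so all members contain \<open>[t]\<close>; tightness at \<open>p\<close>
      would then add \<open>p\<close> to an intersection that already contains \<open>[t]\<close>.\<close>
    obtain X0 Y0 where 0: "X0 \<in> \<A>" "X0 \<inter> {1..p} = {1..t}" "Y0 \<in> \<B>" "Y0 \<inter> {1..p} = {1..t}"
      using 4 p by (auto simp: G.core_def H.core_def)
    obtain X1 Y1 where 1: "X1 \<in> \<A>" "Y1 \<in> \<B>" "p \<in> X1" "p \<in> Y1" "card (X1 \<inter> Y1 \<inter> {1..p}) = t"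
      using tight by blast
    have "{1..t} \<subseteq> X1"
    proof -
      have "X1 \<inter> Y0 \<inter> {1..p} = {1..t} \<inter> X1" using 0 by blast
      then have "card {1..t} \<le> card ({1..t} \<inter> X1)" using within[OF 1(1) 0(3)] by simp
      then have "{1..t} \<inter> X1 = {1..t}" by (intro card_seteq) auto
      then show ?thesis by blast
    qed
    moreover have "{1..t} \<subseteq> Y1"
    proof -
      have "X0 \<inter> Y1 \<inter> {1..p} = {1..t} \<inter> Y1" using 0 by blast
      then have "card {1..t} \<le> card ({1..t} \<inter> Y1)" using within[OF 0(1) 1(2)] by simp
      then have "{1..t} \<inter> Y1 = {1..t}" by (intro card_seteq) auto
      then show ?thesis by blast
    qed
    ultimately have "insert p {1..t} \<subseteq> X1 \<inter> Y1 \<inter> {1..p}" using 1 p by auto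
    then have "card (insert p {1..t}) \<le> card (X1 \<inter> Y1 \<inter> {1..p})" by (intro card_mono) auto
    then show ?thesis using 1 p by simp
  qed
qed

text \<open>The other order of the two trace sizes reduces to this one by exchanging the roles of the families.\<close>
lemma bound_if_smaller_side:
  assumes XY: "X \<in> \<A>" "Y \<in> \<B>" "p \<in> X" "p \<in> Y" "card (X \<inter> Y \<inter> {1..p}) = t"
    and le: "card (X \<inter> {1..p}) \<le> card (Y \<inter> {1..p})"
  shows "sum g \<A> * sum h \<B> \<le> sum g G.star * sum h H.star
    \<and> (real t < c \<longrightarrow> sum g \<A> * sum h \<B> < sum g G.star * sum h H.star)"
proof -
  let ?i = "card (X \<inter> {1..p})" and ?j = "card (Y \<inter> {1..p})"
  have ij: "?i + ?j = p + t" using critical_card XY by blast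
  have "t \<le> ?i" using tight_size_ge XY by blast
  have X: "X \<in> critical t p \<A> \<B> ?i" using XY unfolding critical_def by blast
  have Y: "Y \<in> critical t p \<B> \<A> ?j"
    using XY unfolding critical_def by (auto simp: Int_commute)
  consider "?i = t" | "t < ?i" "t + 2 \<le> ?j" | "?i = t + 1" "?j = t + 1"
    using \<open>t \<le> ?i\<close> le by linarith
  then show ?thesis
  proof cases
    case 1
    have "critical t p \<A> \<B> t \<noteq> {}" using X unfolding 1 by (metis empty_iff)
    then show ?thesis using bound_if_critical_t by blast
  next
    case 2
    have "critical t p \<A> \<B> ?i \<noteq> {}" "critical t p \<B> \<A> ?j \<noteq> {}" using X Y by auto
    then have False by (rule not_unbalanced[OF ij 2(1) le 2(2)])
    then show ?thesis ..
  next
    case 3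
    then have "p = t + 2" using ij by simp
    moreover have "critical t p \<A> \<B> (t + 1) \<noteq> {}" "critical t p \<B> \<A> (t + 1) \<noteq> {}"
      using X Y unfolding 3 by (metis empty_iff)+
    ultimately show ?thesis by (rule bound_if_balanced)
  qed
qed

lemma bound:
  "sum g \<A> * sum h \<B> \<le> sum g G.star * sum h H.star
    \<and> (real t < c \<longrightarrow> sum g \<A> * sum h \<B> < sum g G.star * sum h H.star)"
proof -
  interpret swapped: critical_level n t c H h G g \<B> \<A> p by (rule swap_level)
  obtain X Y where XY: "X \<in> \<A>" "Y \<in> \<B>" "p \<in> X" "p \<in> Y" "card (X \<inter> Y \<inter> {1..p}) = t"
    using tight by blast
  show ?thesis
  proof (cases "card (X \<inter> {1..p}) \<le> card (Y \<inter> {1..p})")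
    case True
    then show ?thesis using bound_if_smaller_side XY by blast
  next
    case False
    have "card (Y \<inter> X \<inter> {1..p}) = t" using XY(5) by (simp only: Int_commute)
    then show ?thesis
      using swapped.bound_if_smaller_side[of Y X] XY False by (simp add: mult.commute)
  qed
qed

end

section \<open>Extremal pairs\<close>

lemma mult_eq_imp_eq:
  fixes a b A B :: real
  assumes "0 \<le> a" "a \<le> A" "0 \<le> b" "b \<le> B" "0 < A * B" "A * B \<le> a * b"
  shows "a = A" "b = B"
proof -
  have nn: "0 \<le> A" "0 \<le> B" using assms by auto
  then have pos: "0 < A" "0 < B" using assms(5) by (auto simp: zero_less_mult_iff)
  have "A * B \<le> a * B" "A * B \<le> A * b"
    using assms nn mult_left_mono[of b B a] mult_right_mono[of a A b] by linarith+
  then show "a = A" "b = B" using assms pos by auto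
qed

context weighted_pair
begin

definition admissible :: "nat set set \<Rightarrow> nat set set \<Rightarrow> bool" where
  "admissible \<A> \<B> \<longleftrightarrow> \<A> \<subseteq> G \<and> \<B> \<subseteq> H \<and> cross_intersecting t \<A> \<B>"

definition extremal :: "nat set set \<Rightarrow> nat set set \<Rightarrow> bool" where
  "extremal \<A> \<B> \<longleftrightarrow> admissible \<A> \<B> \<and>
    (\<forall>\<A>' \<B>'. admissible \<A>' \<B>' \<longrightarrow> sum g \<A>' * sum h \<B>' \<le> sum g \<A> * sum h \<B>)"

lemma admissible_nonneg: "admissible \<A> \<B> \<Longrightarrow> 0 \<le> sum g \<A> \<and> 0 \<le> sum h \<B>"
  using G.sum_w_nonneg H.sum_w_nonneg by (auto simp: admissible_def)

lemma extremal_exists: "\<exists>\<A> \<B>. extremal \<A> \<B>"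
proof -
  let ?S = "{(\<A>, \<B>). admissible \<A> \<B>}"
  let ?f = "\<lambda>(\<A>, \<B>). sum g \<A> * sum h \<B>"
  have "?S \<subseteq> Pow G \<times> Pow H" by (auto simp: admissible_def)
  then have fin: "finite ?S" using G.finite_F H.finite_F by (simp add: finite_subset)
  have "({}, {}) \<in> ?S" by (simp add: admissible_def cross_intersecting_def)
  then have "Max (?f ` ?S) \<in> ?f ` ?S" using fin by (intro Max_in) auto
  then obtain \<A> \<B> where AB: "admissible \<A> \<B>" "Max (?f ` ?S) = sum g \<A> * sum h \<B>" by auto
  have "sum g \<A>' * sum h \<B>' \<le> sum g \<A> * sum h \<B>" if "admissible \<A>' \<B>'" for \<A>' \<B>'
    unfolding AB(2)[symmetric] using fin that by (intro Max_ge) auto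
  then show ?thesis using AB unfolding extremal_def by blast
qed

text \<open>Choosing \<open>p\<close> minimal is what produces a tight pair at level \<open>p\<close>: some intersection within
  \<open>[p - 1]\<close> has fewer than \<open>t\<close> elements.\<close>
lemma extremal_compressed:
  assumes ext: "extremal \<A> \<B>" and comp: "compressed n \<A>" "compressed n \<B>"
    and pos: "0 < sum g \<A> * sum h \<B>"
  shows "(\<A> \<subseteq> G.star \<and> \<B> \<subseteq> H.star) \<or>
    (sum g \<A> * sum h \<B> \<le> sum g G.star * sum h H.star
      \<and> (real t < c \<longrightarrow> sum g \<A> * sum h \<B> < sum g G.star * sum h H.star))"
proof -
  have sub: "\<A> \<subseteq> G" "\<B> \<subseteq> H" and cross: "\<And>X Y. X \<in> \<A> \<Longrightarrow> Y \<in> \<B> \<Longrightarrow> t \<le> card (X \<inter> Y)"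
    using ext by (auto simp: extremal_def admissible_def cross_intersecting_def)
  have "\<A> \<noteq> {}" "\<B> \<noteq> {}" using pos by auto
  then obtain X0 Y0 where 0: "X0 \<in> \<A>" "Y0 \<in> \<B>" by blast
  define good where "good p \<longleftrightarrow> (\<forall>X\<in>\<A>. \<forall>Y\<in>\<B>. t \<le> card (X \<inter> Y \<inter> {1..p}))" for p
  have "good n"
    unfolding good_def
  proof (intro ballI)
    fix X Y assume XY: "X \<in> \<A>" "Y \<in> \<B>"
    then have "X \<inter> Y \<inter> {1..n} = X \<inter> Y" using sub G.F_sub by blast
    then show "t \<le> card (X \<inter> Y \<inter> {1..n})" using cross[OF XY] by (simp only:)
  qed
  define p where "p = (LEAST p. good p)"
  have good_p: "good p" unfolding p_def using \<open>good n\<close> by (rule LeastI)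
  have "t \<le> card (X0 \<inter> Y0 \<inter> {1..p})" using good_p 0 unfolding good_def by blast
  also have "\<dots> \<le> card {1..p}" by (intro card_mono) auto
  finally have t_le_p: "t \<le> p" by simp
  show ?thesis
  proof (cases "p = t")
    case True
    have "{1..t} \<subseteq> X \<inter> Y" if "X \<in> \<A>" "Y \<in> \<B>" for X Y
    proof -
      have "X \<inter> Y \<inter> {1..t} = {1..t}"
        using good_p that True unfolding good_def by (intro card_seteq) auto
      then show ?thesis by blast
    qed
    then have "{1..t} \<subseteq> X" "{1..t} \<subseteq> Y" if "X \<in> \<A>" "Y \<in> \<B>" for X Y using that by blast+
    then have "\<A> \<subseteq> G.star" "\<B> \<subseteq> H.star"
      using sub 0 unfolding G.star_def H.star_def members_containing_def by blast+
    then show ?thesis by blast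
  next
    case False
    then have "t < p" using t_le_p by simp
    have "\<not> good (p - 1)"
      unfolding p_def using \<open>t < p\<close> by (intro not_less_Least) (simp add: p_def)
    then obtain X Y where XY: "X \<in> \<A>" "Y \<in> \<B>" "card (X \<inter> Y \<inter> {1..p - 1}) < t"
      unfolding good_def by (auto simp: not_le)
    have t_le: "t \<le> card (X \<inter> Y \<inter> {1..p})" using good_p XY unfolding good_def by blast
    have split: "{1..p} = insert p {1..p - 1}" using \<open>t < p\<close> by auto
    have p_mem: "p \<in> X \<inter> Y"
    proof (rule ccontr)
      assume "p \<notin> X \<inter> Y"
      then have "X \<inter> Y \<inter> {1..p} = X \<inter> Y \<inter> {1..p - 1}" unfolding split by blast
      then show False using t_le XY(3) by (simp only:)
    qed
    then have "X \<inter> Y \<inter> {1..p} = insert p (X \<inter> Y \<inter> {1..p - 1})" unfolding split by blast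
    then have "card (X \<inter> Y \<inter> {1..p}) \<le> Suc (card (X \<inter> Y \<inter> {1..p - 1}))"
      by (simp only:, simp add: card_insert_if)
    then have "card (X \<inter> Y \<inter> {1..p}) = t" using t_le XY(3) by linarith
    then have tight: "\<exists>X\<in>\<A>. \<exists>Y\<in>\<B>. p \<in> X \<and> p \<in> Y \<and> card (X \<inter> Y \<inter> {1..p}) = t"
      using XY p_mem by blast
    interpret critical_level n t c G g H h \<A> \<B> p
    proof unfold_locales
      show "\<A> \<subseteq> G" "\<B> \<subseteq> H" "compressed n \<A>" "compressed n \<B>" "t < p"
        by fact+
      show "t \<le> card (X \<inter> Y \<inter> {1..p})" if "X \<in> \<A>" "Y \<in> \<B>" for X Y
        using good_p that unfolding good_def by blast
      show "\<exists>X\<in>\<A>. \<exists>Y\<in>\<B>. p \<in> X \<and> p \<in> Y \<and> card (X \<inter> Y \<inter> {1..p}) = t" by (rule tight)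
      show "sum g \<A>' * sum h \<B>' \<le> sum g \<A> * sum h \<B>"
        if "\<A>' \<subseteq> G" "\<B>' \<subseteq> H" "cross_intersecting t \<A>' \<B>'" for \<A>' \<B>'
        using ext that unfolding extremal_def admissible_def by blast
    qed
    show ?thesis using bound by blast
  qed
qed

theorem product_le:
  assumes "admissible \<A> \<B>"
  shows "sum g \<A> * sum h \<B> \<le> sum g G.star * sum h H.star"
proof -
  obtain \<A>0 \<B>0 where ext0: "extremal \<A>0 \<B>0" using extremal_exists by blast
  then have adm0: "admissible \<A>0 \<B>0" by (simp add: extremal_def)
  obtain \<A>1 \<B>1 where 1: "admissible \<A>1 \<B>1" "compressed n \<A>1" "compressed n \<B>1"
    "sum g \<A>0 \<le> sum g \<A>1" "sum h \<B>0 \<le> sum h \<B>1"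
    using compress_pair[of \<A>0 \<B>0] adm0 unfolding admissible_def by blast
  have ge: "sum g \<A>0 * sum h \<B>0 \<le> sum g \<A>1 * sum h \<B>1"
    using 1 admissible_nonneg[OF adm0] by (intro mult_mono) auto
  then have ext: "extremal \<A>1 \<B>1"
    using ext0 1(1) unfolding extremal_def by (meson order_trans)
  have "sum g \<A>1 * sum h \<B>1 \<le> sum g G.star * sum h H.star"
  proof (cases "0 < sum g \<A>1 * sum h \<B>1")
    case True
    have "sum g \<A>1 * sum h \<B>1 \<le> sum g G.star * sum h H.star"
      if "\<A>1 \<subseteq> G.star" "\<B>1 \<subseteq> H.star"
      using G.sum_mono_subset[OF that(1) G.star_sub] H.sum_mono_subset[OF that(2) H.star_sub]
        admissible_nonneg[OF 1(1)] by (intro mult_mono) auto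
    then show ?thesis using extremal_compressed[OF ext 1(2,3) True] by blast
  next
    case False
    moreover have "0 \<le> sum g G.star * sum h H.star"
      using G.sum_w_nonneg[OF G.star_sub] H.sum_w_nonneg[OF H.star_sub] by simp
    ultimately show ?thesis by linarith
  qed
  then show ?thesis using ext assms unfolding extremal_def by (meson order_trans)
qed

text \<open>The compressed pair obtained from \<open>\<A>\<close> and \<open>\<B>\<close> consists of the stars, whose common member \<open>[t]\<close>
  pulls back to a common \<open>t\<close>-element set \<open>S\<close>. It lies in every member of both families, and the
  families of all members containing \<open>S\<close> are admissible, so extremality leaves no room for proper
  subfamilies.\<close>
theorem product_eq:
  assumes adm: "admissible \<A> \<B>" and c: "real t < c"
    and mem: "X \<in> G" "t \<le> card X" "Y \<in> H" "t \<le> card Y"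
    and eq: "sum g \<A> * sum h \<B> = sum g G.star * sum h H.star"
  shows "\<exists>S. S \<subseteq> {1..n} \<and> card S = t \<and> \<A> = members_containing G S \<and> \<B> = members_containing H S
    \<and> sum g \<A> = sum g G.star \<and> sum h \<B> = sum h H.star"
proof -
  let ?T = "{1..t}"
  have T: "?T \<in> G.star" "?T \<in> H.star"
    using G.initial_mem[OF mem(1,2)] H.initial_mem[OF mem(3,4)]
    by (auto simp: G.star_def H.star_def members_containing_def)
  have stars_pos: "0 < sum g G.star * sum h H.star"
    using G.sum_w_pos[OF G.star_sub T(1)] H.sum_w_pos[OF H.star_sub T(2)] by simp
  obtain \<A>1 \<B>1 where 1: "admissible \<A>1 \<B>1" "compressed n \<A>1" "compressed n \<B>1"
    "sum g \<A> \<le> sum g \<A>1" "sum h \<B> \<le> sum h \<B>1"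
    and pull: "\<And>S. card S = t \<Longrightarrow> S \<in> \<A>1 \<Longrightarrow> S \<in> \<B>1 \<Longrightarrow> \<exists>S'. card S' = t \<and> S' \<in> \<A> \<and> S' \<in> \<B>"
    using compress_pair[of \<A> \<B>] adm unfolding admissible_def by blast
  have "sum g \<A> * sum h \<B> \<le> sum g \<A>1 * sum h \<B>1"
    using 1 admissible_nonneg[OF adm] by (intro mult_mono) auto
  then have eq1: "sum g \<A>1 * sum h \<B>1 = sum g G.star * sum h H.star"
    using product_le[OF 1(1)] eq by linarith
  have "extremal \<A>1 \<B>1" unfolding extremal_def eq1 using 1(1) product_le by blast
  then have sub: "\<A>1 \<subseteq> G.star" "\<B>1 \<subseteq> H.star"
    using extremal_compressed[OF _ 1(2,3)] stars_pos eq1 c by auto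
  have le: "sum g \<A>1 \<le> sum g G.star" "sum h \<B>1 \<le> sum h H.star"
    using G.sum_mono_subset[OF sub(1) G.star_sub] H.sum_mono_subset[OF sub(2) H.star_sub] by auto
  have nn: "0 \<le> sum g \<A>" "0 \<le> sum h \<B>" "0 \<le> sum g \<A>1" "0 \<le> sum h \<B>1"
    using admissible_nonneg[OF adm] admissible_nonneg[OF 1(1)] by auto
  have eqs1: "sum g \<A>1 = sum g G.star" "sum h \<B>1 = sum h H.star"
    using mult_eq_imp_eq[OF nn(3) le(1) nn(4) le(2) stars_pos] eq1 by auto
  have eqs: "sum g \<A> = sum g G.star" "sum h \<B> = sum h H.star"
    using mult_eq_imp_eq[OF nn(1) _ nn(2) _ stars_pos] 1(4,5) eqs1 eq by auto
  have "\<A>1 = G.star" "\<B>1 = H.star"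
    using G.eq_of_sum_ge[OF sub(1) G.star_sub] H.eq_of_sum_ge[OF sub(2) H.star_sub] eqs1 by auto
  then obtain S where S: "card S = t" "S \<in> \<A>" "S \<in> \<B>" using pull[of ?T] T by auto
  have SG: "S \<in> G" using S adm by (auto simp: admissible_def)
  have finS: "finite S" using SG G.finite_member by blast
  have contains: "S \<subseteq> Z" if "t \<le> card (S \<inter> Z)" for Z
  proof -
    have "S \<inter> Z = S" using that S(1) finS by (intro card_seteq) auto
    then show ?thesis by blast
  qed
  have meet: "\<And>P Q. P \<in> \<A> \<Longrightarrow> Q \<in> \<B> \<Longrightarrow> t \<le> card (P \<inter> Q)"
    using adm by (auto simp: admissible_def cross_intersecting_def)
  let ?GS = "members_containing G S" and ?HS = "members_containing H S"
  have subS: "\<A> \<subseteq> ?GS" "\<B> \<subseteq> ?HS"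
    using adm contains meet[OF S(2)] meet[OF _ S(3)]
    unfolding members_containing_def admissible_def by (auto simp: Int_commute)
  have in_F: "?GS \<subseteq> G" "?HS \<subseteq> H" by (auto simp: members_containing_def)
  have admS: "admissible ?GS ?HS"
    unfolding admissible_def cross_intersecting_def
  proof (intro conjI in_F ballI)
    fix P Q assume PQ: "P \<in> ?GS" "Q \<in> ?HS"
    then have "S \<subseteq> P \<inter> Q" "finite P" using G.finite_member by (auto simp: members_containing_def)
    then have "card S \<le> card (P \<inter> Q)" by (intro card_mono) auto
    then show "t \<le> card (P \<inter> Q)" using S(1) by simp
  qed
  have leS: "sum g \<A> \<le> sum g ?GS" "sum h \<B> \<le> sum h ?HS"
    using G.sum_mono_subset[OF subS(1) in_F(1)] H.sum_mono_subset[OF subS(2) in_F(2)] by auto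
  have "sum g ?GS * sum h ?HS = sum g \<A> * sum h \<B>"
    using product_le[OF admS] eq mult_mono[OF leS] nn leS by linarith
  then have "sum g \<A> = sum g ?GS" "sum h \<B> = sum h ?HS"
    using mult_eq_imp_eq[OF nn(1) leS(1) nn(2) leS(2)] stars_pos eq by simp_all
  then have "\<A> = ?GS" "\<B> = ?HS"
    using G.eq_of_sum_ge[OF subS(1) in_F(1)] H.eq_of_sum_ge[OF subS(2) in_F(2)] by auto
  moreover have "S \<subseteq> {1..n}" using SG G.F_sub by blast
  ultimately show ?thesis using S(1) eqs by blast
qed

end

theorem theorem1p3:
  fixes n t :: nat and u :: real and T :: "nat set"
    and G H \<A> \<B> :: "nat set set"
    and g h :: "nat set \<Rightarrow> real"
  assumes "1 \<le> t" and "t \<le> n" and "T = {1..t}"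
    and "0 \<le> u" and "u > (6 - real t) / 3"
    and "G \<subseteq> Pow {1..n}" and "G \<noteq> {}" and "compressed n G" and "hereditary G"
    and "H \<subseteq> Pow {1..n}" and "H \<noteq> {}" and "compressed n H" and "hereditary H"
    and "\<forall>A\<in>G. 0 < g A" and "\<forall>A\<in>H. 0 < h A"
    and a: "\<And>F w. (F, w) \<in> {(G, g), (H, h)} \<Longrightarrow>
          \<forall>A\<in>F. \<forall>B\<in>F. A \<subset> B \<and> t \<le> card A \<longrightarrow> w A \<ge> (real t + u) * w B"
    and b: "\<And>F w. (F, w) \<in> {(G, g), (H, h)} \<Longrightarrow>
          \<forall>C\<in>F. \<forall>i\<in>{1..n}. \<forall>j\<in>{1..n}. i < j \<longrightarrow> w (shift i j C) \<ge> w C"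
    and "\<A> \<subseteq> G" and "\<B> \<subseteq> H" and "cross_intersecting t \<A> \<B>"
  shows "sum g \<A> * sum h \<B> \<le> sum g (members_containing G T) * sum h (members_containing H T)
    \<and> (u > 0 \<and> (\<exists>A\<in>G. t \<le> card A) \<and> (\<exists>B\<in>H. t \<le> card B) \<longrightarrow>
        (sum g \<A> * sum h \<B> = sum g (members_containing G T) * sum h (members_containing H T)
         \<longleftrightarrow>
         (\<exists>T'. T' \<subseteq> {1..n} \<and> card T' = t
            \<and> \<A> = members_containing G T' \<and> \<B> = members_containing H T'
            \<and> sum g (members_containing G T') = sum g (members_containing G T)
            \<and> sum h (members_containing H T') = sum h (members_containing H T))))"
proof -
  have "6 - real t < 3 * u" using assms(5) by (simp add: field_simps)
  then have c: "real t \<le> real t + u" "2 * real t + 6 < 3 * (real t + u)" using assms(4) by auto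
  interpret weighted_pair n t "real t + u" G g H h
  proof unfold_locales
    show "1 \<le> t" "real t \<le> real t + u" "2 * real t + 6 < 3 * (real t + u)"
      "G \<subseteq> Pow {1..n}" "compressed n G" "hereditary G"
      "H \<subseteq> Pow {1..n}" "compressed n H" "hereditary H" by fact+
    show "0 < g X" if "X \<in> G" for X using assms(14) that by blast
    show "0 < h X" if "X \<in> H" for X using assms(15) that by blast
    show "(real t + u) * g Y \<le> g X" if "X \<in> G" "Y \<in> G" "X \<subset> Y" "t \<le> card X" for X Y
      using a[of G g] that by blast
    show "(real t + u) * h Y \<le> h X" if "X \<in> H" "Y \<in> H" "X \<subset> Y" "t \<le> card X" for X Y
      using a[of H h] that by blast
    show "g X \<le> g (shift i j X)" if "X \<in> G" "i \<in> {1..n}" "j \<in> {1..n}" "i < j" for X i j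
      using b[of G g] that by blast
    show "h X \<le> h (shift i j X)" if "X \<in> H" "i \<in> {1..n}" "j \<in> {1..n}" "i < j" for X i j
      using b[of H h] that by blast
  qed
  have stars: "members_containing G T = G.star" "members_containing H T = H.star"
    by (simp_all add: assms(3) G.star_def H.star_def)
  have adm: "admissible \<A> \<B>"
    unfolding admissible_def using assms(18-20) by blast
  have le: "sum g \<A> * sum h \<B> \<le> sum g (members_containing G T) * sum h (members_containing H T)"
    unfolding stars by (rule product_le[OF adm])
  have "\<exists>S. S \<subseteq> {1..n} \<and> card S = t \<and> \<A> = members_containing G S \<and> \<B> = members_containing H S
      \<and> sum g \<A> = sum g G.star \<and> sum h \<B> = sum h H.star"
    if "0 < u" "X \<in> G" "t \<le> card X" "Y \<in> H" "t \<le> card Y"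
      "sum g \<A> * sum h \<B> = sum g G.star * sum h H.star" for X Y
    using product_eq[OF adm _ that(2-6)] that(1) by simp
  then show ?thesis
    using le unfolding stars by metis
qed

end
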